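(* Let $G$ be a finite group, $\alpha$ an action of $G$ on a unital simple $C^*$-algebra $A$, and $E$ the canonical conditional expectation from $A$ onto the fixed point algebra $A^{\alpha}$, $E(x)=\frac{1}{\#G}\sum_{g\in G}\alpha_g(x)$. Then $\alpha$ has the Rohlin property if and only if $E$ has the Rohlin property.
   Context: Let $P\subset A$ be unital $C^*$-algebras with common unit and $E:A\to P$ a conditional expectation. A quasi-basis for $E$ is a finite set $\{(u_i,v_i)\}_{i=1}^n\subset A\times A$ with $a=\sum_i u_iE(v_ia)=\sum_i E(au_i)v_i$ for all $a\in A$. If one exists, $E$ is said to have a finite index and $\mathrm{Index}\,E=\sum_i u_iv_i$ (independent of the choice of quasi-basis; a positive central invertible element of $A$). Put $A^\infty=\ell^\infty(\mathbb{N},A)/c_0(A)$, where $c_0(A)$ is the ideal of sequences with $\|a_n\|\to0$; $A$ is identified with the classes of constant sequences, and $A_\infty=A^\infty\cap A'$. $P^\infty$ is regarded as a subalgebra of $A^\infty$. $E^\infty:A^\infty\to P^\infty$ is the conditional expectation induced by $E$ termwise. For $\alpha\in\mathrm{Aut}(A)$, $\alpha_\infty$ is the automorphism of $A_\infty$ induced termwise. Rohlin property of an action: an action $\alpha$ of a finite group $G$ on a unital $C^*$-algebra $A$ has the Rohlin property if there is a partition of unity $\{e_g\}_{g\in G}\subset A_\infty$ consisting of projections with $(\alpha_g)_\infty(e_h)=e_{gh}$ for all $g,h\in G$. Rohlin property of a conditional expectation: a conditional expectation $E:A\to P$ with a finite index has the Rohlin property if there is a projection $e\in A_\infty$ with $E^\infty(e)=(\mathrm{Index}\,E)^{-1}\cdot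 1$ and such that the map $A\ni x\mapsto xe$ is injective. $\#G$ denotes the order of $G$, and $A^\alpha=\{x\in A:\alpha_g(x)=x\ \text{for all } g\in G\}$.
   Formalization: The action α is additionally assumed faithful (g ↦ α_g injective); without this the claim fails, e.g. for a nontrivial finite group acting trivially on the complex numbers, where E = id has the Rohlin property but α does not. *)

theory Defs
  imports Complex_Main "HOL-Algebra.Coset"
begin

class scaleC =
  fixes scaleC :: "complex \<Rightarrow> 'a \<Rightarrow> 'a"  (infixr \<open>*\<^sub>C\<close> 75)

class complex_star_algebra_1 = ring_1 + scaleC +
  fixes star :: "'a \<Rightarrow> 'a"
  assumes scaleC_add_right: "c *\<^sub>C (x + y) = c *\<^sub>C x + c *\<^sub>C y"
    and scaleC_add_left: "(c + d) *\<^sub>C x = c *\<^sub>C x + d *\<^sub>C x"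
    and scaleC_scaleC: "c *\<^sub>C (d *\<^sub>C x) = (c * d) *\<^sub>C x"
    and scaleC_one: "1 *\<^sub>C x = x"
    and mult_scaleC_left: "(c *\<^sub>C x) * y = c *\<^sub>C (x * y)"
    and mult_scaleC_right: "x * (c *\<^sub>C y) = c *\<^sub>C (x * y)"
    and star_add: "star (x + y) = star x + star y"
    and star_scaleC: "star (c *\<^sub>C x) = cnj c *\<^sub>C star x"
    and star_mult: "star (x * y) = star y * star x"
    and star_star: "star (star x) = x"

text \<open>The norm axioms of \<^class>\<open>real_normed_algebra_1\<close> include \<open>norm 1 = 1\<close>, so the zero
  algebra is excluded.\<close>

class unital_cstar_algebra = complex_star_algebra_1 + real_normed_algebra_1 + banach +
  assumes scaleR_eq_scaleC: "scaleR r x = complex_of_real r *\<^sub>C x"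
    and norm_scaleC: "norm (c *\<^sub>C x) = cmod c * norm x"
    and cstar_identity: "norm (star x * x) = (norm x)\<^sup>2"

definition complex_linear :: "('a::complex_star_algebra_1 \<Rightarrow> 'b::complex_star_algebra_1) \<Rightarrow> bool" where
  "complex_linear T \<longleftrightarrow>
     (\<forall>x y. T (x + y) = T x + T y) \<and> (\<forall>c x. T (c *\<^sub>C x) = c *\<^sub>C T x)"

definition projection :: "'a::complex_star_algebra_1 \<Rightarrow> bool" where
  "projection p \<longleftrightarrow> star p = p \<and> p * p = p"

definition closed_ideal :: "'a::unital_cstar_algebra set \<Rightarrow> bool" where
  "closed_ideal I \<longleftrightarrow> closed I \<and> 0 \<in> I \<and> (\<forall>x\<in>I. \<forall>y\<in>I. x + y \<in> I) \<and>
     (\<forall>c. \<forall>x\<in>I. c *\<^sub>C x \<in> I) \<and> (\<forall>a. \<forall>x\<in>I. a * x \<in> I \<and> x * a \<in> I)"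

definition simple_cstar_algebra :: "'a::unital_cstar_algebra itself \<Rightarrow> bool" where
  "simple_cstar_algebra _ \<longleftrightarrow> (\<forall>I :: 'a set. closed_ideal I \<longrightarrow> I = {0} \<or> I = UNIV)"

definition unital_cstar_subalgebra :: "'a::unital_cstar_algebra set \<Rightarrow> bool" where
  "unital_cstar_subalgebra P \<longleftrightarrow> closed P \<and> 1 \<in> P \<and>
     (\<forall>x\<in>P. \<forall>y\<in>P. x + y \<in> P \<and> x * y \<in> P) \<and> (\<forall>c. \<forall>x\<in>P. c *\<^sub>C x \<in> P) \<and> (\<forall>x\<in>P. star x \<in> P)"

definition star_automorphism :: "('a::unital_cstar_algebra \<Rightarrow> 'a) \<Rightarrow> bool" where
  "star_automorphism \<phi> \<longleftrightarrow> bij \<phi> \<and> complex_linear \<phi> \<and>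
     (\<forall>x y. \<phi> (x * y) = \<phi> x * \<phi> y) \<and> (\<forall>x. \<phi> (star x) = star (\<phi> x))"

definition star_Aut :: "('a::unital_cstar_algebra \<Rightarrow> 'a) monoid" where
  "star_Aut = \<lparr>carrier = {\<phi>. star_automorphism \<phi>}, monoid.mult = (\<circ>), one = id\<rparr>"

text \<open>The sequence algebra \<open>\<ell>\<^sup>\<infinity>(\<nat>, A) / c\<^sub>0(A)\<close>, as a unital complex star-algebra.\<close>

definition seq_eq :: "(nat \<Rightarrow> 'a::real_normed_vector) \<Rightarrow> (nat \<Rightarrow> 'a) \<Rightarrow> bool" where
  "seq_eq f g \<longleftrightarrow> Bseq f \<and> Bseq g \<and> (\<lambda>n. norm (f n - g n)) \<longlonglongrightarrow> 0"

lemma seq_eq_part_equivp: "part_equivp (seq_eq :: (nat \<Rightarrow> 'a::real_normed_vector) \<Rightarrow> _)"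
proof (rule part_equivpI)
  have "seq_eq (\<lambda>_. 0 :: 'a) (\<lambda>_. 0)" by (simp add: seq_eq_def)
  then show "\<exists>f :: nat \<Rightarrow> 'a. seq_eq f f" by blast
  show "symp (seq_eq :: (nat \<Rightarrow> 'a) \<Rightarrow> _)"
    by (auto simp: symp_def seq_eq_def norm_minus_commute)
  show "transp (seq_eq :: (nat \<Rightarrow> 'a) \<Rightarrow> _)"
  proof (rule transpI)
    fix f g h :: "nat \<Rightarrow> 'a" assume "seq_eq f g" "seq_eq g h"
    then have "Bseq f" "Bseq h" and l: "(\<lambda>n. f n - g n) \<longlonglongrightarrow> 0" "(\<lambda>n. g n - h n) \<longlonglongrightarrow> 0"
      by (auto simp: seq_eq_def tendsto_norm_zero_iff)
    with tendsto_add[OF l] show "seq_eq f h" by (simp add: seq_eq_def tendsto_norm_zero_iff)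
  qed
qed

quotient_type (overloaded) 'a seqalg = "nat \<Rightarrow> 'a::real_normed_vector" / partial: seq_eq
  by (rule seq_eq_part_equivp)

lemma norm_star: "norm (star x) = norm (x :: 'a::unital_cstar_algebra)"
proof -
  have le: "norm y \<le> norm (star y)" for y :: 'a
  proof (cases "norm y = 0")
    case False
    have "norm y * norm y \<le> norm (star y) * norm y"
      using cstar_identity[of y] norm_mult_ineq[of "star y" y] by (simp add: power2_eq_square)
    with False show ?thesis by (simp add: mult_le_cancel_right)
  qed simp
  show ?thesis using le[of x] le[of "star x"] by (simp add: star_star)
qed

lemma Bseq_mult_alg:
  fixes f g :: "nat \<Rightarrow> 'a::real_normed_algebra"
  assumes "Bseq f" "Bseq g" shows "Bseq (\<lambda>n. f n * g n)"
proof -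
  obtain K L where K: "0 < K" "\<forall>n. norm (f n) \<le> K" and L: "\<forall>n. norm (g n) \<le> L"
    using assms by (metis BseqE)
  have "norm (f n * g n) \<le> K * L" for n
    using K L by (intro order_trans[OF norm_mult_ineq] mult_mono) auto
  then show ?thesis by (rule BseqI')
qed

lemma Bseq_add_alg:
  fixes f g :: "nat \<Rightarrow> 'a::real_normed_vector"
  assumes "Bseq f" "Bseq g" shows "Bseq (\<lambda>n. f n + g n)"
proof -
  obtain K L where K: "\<forall>n. norm (f n) \<le> K" and L: "\<forall>n. norm (g n) \<le> L"
    using assms by (metis BseqE)
  have "norm (f n + g n) \<le> K + L" for n
    using K L by (intro order_trans[OF norm_triangle_ineq] add_mono) auto
  then show ?thesis by (rule BseqI')
qed

lemma Bseq_scaleC: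
  fixes f :: "nat \<Rightarrow> 'a::unital_cstar_algebra"
  assumes "Bseq f" shows "Bseq (\<lambda>n. c *\<^sub>C f n)"
proof -
  obtain K where "\<forall>n. norm (f n) \<le> K" using assms by (metis BseqE)
  then have "norm (c *\<^sub>C f n) \<le> cmod c * K" for n
    by (simp add: norm_scaleC mult_left_mono)
  then show ?thesis by (rule BseqI')
qed

lemma Bseq_star:
  fixes f :: "nat \<Rightarrow> 'a::unital_cstar_algebra"
  assumes "Bseq f" shows "Bseq (\<lambda>n. star (f n))"
proof -
  obtain K where "\<forall>n. norm (f n) \<le> K" using assms by (metis BseqE)
  then have "norm (star (f n)) \<le> K" for n
    by (simp add: norm_star)
  then show ?thesis by (rule BseqI')
qed

lemma star_minus: "star (- x) = - star (x :: 'a::complex_star_algebra_1)"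
  by (metis add.right_inverse add_cancel_right_left minus_unique star_add)

lemma star_diff: "star (x - y) = star x - star (y :: 'a::complex_star_algebra_1)"
  by (metis diff_conv_add_uminus star_add star_minus)

lemma scaleC_diff_right: "c *\<^sub>C (x - y) = c *\<^sub>C x - c *\<^sub>C (y :: 'a::complex_star_algebra_1)"
  by (metis add_diff_cancel diff_add_cancel scaleC_add_right)

instantiation seqalg :: (unital_cstar_algebra) complex_star_algebra_1
begin

lift_definition zero_seqalg :: "'a seqalg" is "\<lambda>_. 0"
  by (simp add: seq_eq_def)

lift_definition one_seqalg :: "'a seqalg" is "\<lambda>_. 1"
  by (simp add: seq_eq_def)

lift_definition plus_seqalg :: "'a seqalg \<Rightarrow> 'a seqalg \<Rightarrow> 'a seqalg" is "\<lambda>f g n. f n + g n"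
proof -
  fix f f' g g' :: "nat \<Rightarrow> 'a" assume a: "seq_eq f f'" "seq_eq g g'"
  then have "(\<lambda>n. (f n - f' n) + (g n - g' n)) \<longlonglongrightarrow> 0 + 0"
    unfolding seq_eq_def by (intro tendsto_add) (auto simp: tendsto_norm_zero_iff)
  then show "seq_eq (\<lambda>n. f n + g n) (\<lambda>n. f' n + g' n)"
    using a by (simp add: seq_eq_def tendsto_norm_zero_iff Bseq_add_alg algebra_simps)
qed

lift_definition uminus_seqalg :: "'a seqalg \<Rightarrow> 'a seqalg" is "\<lambda>f n. - f n"
  by (simp add: seq_eq_def Bseq_minus_iff norm_minus_commute)

definition minus_seqalg :: "'a seqalg \<Rightarrow> 'a seqalg \<Rightarrow> 'a seqalg" where
  "minus_seqalg x y = x + - y"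

lift_definition times_seqalg :: "'a seqalg \<Rightarrow> 'a seqalg \<Rightarrow> 'a seqalg" is "\<lambda>f g n. f n * g n"
proof -
  fix f f' g g' :: "nat \<Rightarrow> 'a" assume a: "seq_eq f f'" "seq_eq g g'"
  have "(\<lambda>n. f n * (g n - g' n)) \<longlonglongrightarrow> 0" "(\<lambda>n. (f n - f' n) * g' n) \<longlonglongrightarrow> 0"
  proof -
    have z: "Zfun (\<lambda>n. f n - f' n) sequentially" "Zfun (\<lambda>n. g n - g' n) sequentially"
      and b: "Bseq f" "Bseq g'"
      using a by (auto simp: seq_eq_def tendsto_norm_zero_iff tendsto_Zfun_iff Zfun_norm_iff)
    show "(\<lambda>n. f n * (g n - g' n)) \<longlonglongrightarrow> 0" "(\<lambda>n. (f n - f' n) * g' n) \<longlonglongrightarrow> 0"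
      using bounded_bilinear.Bfun_prod_Zfun[OF bounded_bilinear_mult b(1) z(2)]
        bounded_bilinear.Zfun_prod_Bfun[OF bounded_bilinear_mult z(1) b(2)]
      by (simp_all add: tendsto_Zfun_iff)
  qed
  then have "(\<lambda>n. f n * (g n - g' n) + (f n - f' n) * g' n) \<longlonglongrightarrow> 0 + 0"
    by (rule tendsto_add)
  then show "seq_eq (\<lambda>n. f n * g n) (\<lambda>n. f' n * g' n)"
    using a by (simp add: seq_eq_def tendsto_norm_zero_iff Bseq_mult_alg algebra_simps)
qed

lift_definition scaleC_seqalg :: "complex \<Rightarrow> 'a seqalg \<Rightarrow> 'a seqalg" is "\<lambda>c f n. c *\<^sub>C f n"
proof -
  fix c and f g :: "nat \<Rightarrow> 'a" assume a: "seq_eq f g"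
  have "(\<lambda>n. cmod c * norm (f n - g n)) \<longlonglongrightarrow> cmod c * 0"
    using a unfolding seq_eq_def by (intro tendsto_mult tendsto_const) simp
  then show "seq_eq (\<lambda>n. c *\<^sub>C f n) (\<lambda>n. c *\<^sub>C g n)"
    using a by (simp add: seq_eq_def Bseq_scaleC scaleC_diff_right[symmetric] norm_scaleC)
qed

lift_definition star_seqalg :: "'a seqalg \<Rightarrow> 'a seqalg" is "\<lambda>f n. star (f n)"
  by (simp add: seq_eq_def star_diff[symmetric] norm_star Bseq_def)

lemma seqalg_Bseq: "seq_eq f f \<longleftrightarrow> Bseq f"
  by (simp add: seq_eq_def)

instance
proof
  fix x y z :: "'a seqalg" and c d :: complex
  show "x + y + z = x + (y + z)"
    by transfer (simp add: seqalg_Bseq Bseq_add_alg add.assoc)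
  show "x + y = y + x"
    by transfer (simp add: seqalg_Bseq Bseq_add_alg add.commute)
  show "0 + x = x" by transfer (simp add: seqalg_Bseq)
  show "- x + x = 0" by transfer (simp add: seq_eq_def)
  show "x - y = x + - y" by (simp add: minus_seqalg_def)
  show "x * y * z = x * (y * z)"
    by transfer (simp add: seqalg_Bseq Bseq_mult_alg mult.assoc)
  show "(0 :: 'a seqalg) \<noteq> 1" by transfer (simp add: seq_eq_def LIMSEQ_const_iff)
  show "1 * x = x" "x * 1 = x" by (transfer, simp add: seqalg_Bseq)+
  show "(x + y) * z = x * z + y * z" "x * (y + z) = x * y + x * z"
    by (transfer, simp add: seqalg_Bseq Bseq_mult_alg Bseq_add_alg algebra_simps)+
  show "c *\<^sub>C (x + y) = c *\<^sub>C x + c *\<^sub>C y"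
    by transfer (simp add: seqalg_Bseq Bseq_scaleC Bseq_add_alg scaleC_add_right)
  show "(c + d) *\<^sub>C x = c *\<^sub>C x + d *\<^sub>C x"
    by transfer (simp add: seqalg_Bseq Bseq_scaleC Bseq_add_alg scaleC_add_left)
  show "c *\<^sub>C (d *\<^sub>C x) = (c * d) *\<^sub>C x"
    by transfer (simp add: seqalg_Bseq Bseq_scaleC scaleC_scaleC)
  show "1 *\<^sub>C x = x"
    by transfer (simp add: seqalg_Bseq scaleC_one)
  show "(c *\<^sub>C x) * y = c *\<^sub>C (x * y)" "x * (c *\<^sub>C y) = c *\<^sub>C (x * y)"
    by (transfer, simp add: seqalg_Bseq Bseq_scaleC Bseq_mult_alg mult_scaleC_left mult_scaleC_right)+
  show "star (x + y) = star x + star y"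
    by transfer (simp add: seqalg_Bseq Bseq_star Bseq_add_alg star_add)
  show "star (c *\<^sub>C x) = cnj c *\<^sub>C star x"
    by transfer (simp add: seqalg_Bseq Bseq_star Bseq_scaleC star_scaleC)
  show "star (x * y) = star y * star x"
    by transfer (simp add: seqalg_Bseq Bseq_star Bseq_mult_alg star_mult)
  show "star (star x) = x"
    by transfer (simp add: seqalg_Bseq Bseq_star star_star)
qed

end

lift_definition const_seq :: "'a::unital_cstar_algebra \<Rightarrow> 'a seqalg" is "\<lambda>a n. a"
  by (simp add: seq_eq_def)

definition central_sequences :: "'a::unital_cstar_algebra seqalg set" where
  "central_sequences = {x. \<forall>a. x * const_seq a = const_seq a * x}"

text \<open>The map induced termwise on classes of sequences is computed on a chosen representative;
  the lemma below shows that for bounded \<open>T\<close> the choice does not matter. Conditional expectations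
  are contractive, and star-automorphisms are automatically isometric.\<close>

definition induced_map :: "('a::unital_cstar_algebra \<Rightarrow> 'a) \<Rightarrow> 'a seqalg \<Rightarrow> 'a seqalg" where
  "induced_map T x = abs_seqalg (\<lambda>n. T (rep_seqalg x n))"

lemma induced_map_abs:
  fixes T :: "'a::unital_cstar_algebra \<Rightarrow> 'a"
  assumes T: "bounded_linear T" and f: "Bseq f"
  shows "induced_map T (abs_seqalg f) = abs_seqalg (\<lambda>n. T (f n))"
proof -
  let ?r = "rep_seqalg (abs_seqalg f)"
  have "seq_eq ?r f"
    using f Quotient3_seqalg by (metis Quotient3_rep_abs seqalg_Bseq)
  then have r: "Bseq ?r" "(\<lambda>n. ?r n - f n) \<longlonglongrightarrow> 0"
    by (auto simp: seq_eq_def tendsto_norm_zero_iff)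
  have "Bseq (\<lambda>n. T (h n))" if h: "Bseq h" for h :: "nat \<Rightarrow> 'a"
  proof -
    obtain K where K: "\<forall>n. norm (h n) \<le> K" using h by (metis BseqE)
    obtain M where M: "0 < M" "\<And>x. norm (T x) \<le> norm x * M"
      using bounded_linear.pos_bounded[OF T] by blast
    have "norm (T (h n)) \<le> K * M" for n
      using K M by (intro order_trans[OF M(2)] mult_right_mono) auto
    then show ?thesis by (rule BseqI')
  qed
  moreover have "(\<lambda>n. T (?r n - f n)) \<longlonglongrightarrow> 0"
    using bounded_linear.tendsto_zero[OF T] r by blast
  ultimately have "seq_eq (\<lambda>n. T (?r n)) (\<lambda>n. T (f n))"
    using r f by (simp add: seq_eq_def tendsto_norm_zero_iff
        linear_diff[OF bounded_linear.linear[OF T]])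
  then show ?thesis
    unfolding induced_map_def using Quotient3_rel_abs[OF Quotient3_seqalg] by blast
qed

text \<open>A conditional expectation onto a unital C*-subalgebra \<open>P\<close>: a linear, \<open>P\<close>-bimodular projection
  of norm one onto \<open>P\<close>. Positivity is then automatic (Tomiyama).\<close>

definition conditional_expectation ::
  "'a::unital_cstar_algebra set \<Rightarrow> ('a \<Rightarrow> 'a) \<Rightarrow> bool" where
  "conditional_expectation P E \<longleftrightarrow> unital_cstar_subalgebra P \<and> complex_linear E \<and>
     (\<forall>x. E x \<in> P) \<and> (\<forall>p\<in>P. E p = p) \<and>
     (\<forall>p\<in>P. \<forall>x. E (p * x) = p * E x \<and> E (x * p) = E x * p) \<and>
     (\<forall>x. norm (E x) \<le> norm x)"

definition quasi_basis ::
  "('a::unital_cstar_algebra \<Rightarrow> 'a) \<Rightarrow> nat \<Rightarrow> (nat \<Rightarrow> 'a) \<Rightarrow> (nat \<Rightarrow> 'a) \<Rightarrow> bool" where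
  "quasi_basis E n u v \<longleftrightarrow>
     (\<forall>a. a = (\<Sum>i<n. u i * E (v i * a)) \<and> a = (\<Sum>i<n. E (a * u i) * v i))"

definition finite_index :: "('a::unital_cstar_algebra \<Rightarrow> 'a) \<Rightarrow> bool" where
  "finite_index E \<longleftrightarrow> (\<exists>n u v. quasi_basis E n u v)"

definition Index :: "('a::unital_cstar_algebra \<Rightarrow> 'a) \<Rightarrow> 'a" where
  "Index E = (THE z. \<exists>n u v. quasi_basis E n u v \<and> z = (\<Sum>i<n. u i * v i))"

text \<open>Independence of the quasi-basis: the definite description in \<open>Index\<close> is proper.\<close>

lemma Index_eq:
  assumes E: "complex_linear E" and uv: "quasi_basis E n u v"
  shows "Index E = (\<Sum>i<n. u i * v i)"
proof -
  have "(\<Sum>i<m. s i * t i) = (\<Sum>i<n. u i * v i)" if st: "quasi_basis E m s t" for m s t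
  proof -
    have "(\<Sum>j<m. s j * t j) = (\<Sum>j<m. (\<Sum>i<n. u i * E (v i * s j)) * t j)"
      using uv unfolding quasi_basis_def by (intro sum.cong refl arg_cong2[where f = times]) blast+
    also have "\<dots> = (\<Sum>j<m. \<Sum>i<n. u i * (E (v i * s j) * t j))"
      by (simp add: sum_distrib_right mult.assoc)
    also have "\<dots> = (\<Sum>i<n. \<Sum>j<m. u i * (E (v i * s j) * t j))"
      by (rule sum.swap)
    also have "\<dots> = (\<Sum>i<n. u i * (\<Sum>j<m. E (v i * s j) * t j))"
      by (simp add: sum_distrib_left)
    also have "\<dots> = (\<Sum>i<n. u i * v i)"
      using st unfolding quasi_basis_def by (intro sum.cong refl arg_cong2[where f = times]) metis+
    finally show ?thesis .
  qed
  then show ?thesis unfolding Index_def using uv by (intro the_equality) blast+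
qed

definition rohlin_expectation ::
  "'a::unital_cstar_algebra set \<Rightarrow> ('a \<Rightarrow> 'a) \<Rightarrow> bool" where
  "rohlin_expectation P E \<longleftrightarrow> conditional_expectation P E \<and> finite_index E \<and>
     (\<exists>e\<in>central_sequences. projection e \<and>
        (\<exists>j. j * Index E = 1 \<and> Index E * j = 1 \<and> induced_map E e = const_seq j) \<and>
        inj (\<lambda>x. const_seq x * e))"

text \<open>Orthogonality of projections that sum to \<open>1\<close> is automatic; it is listed as part of the usual
  meaning of a partition of unity by projections.\<close>

definition rohlin_action ::
  "('g, 'b) monoid_scheme \<Rightarrow> ('g \<Rightarrow> 'a::unital_cstar_algebra \<Rightarrow> 'a) \<Rightarrow> bool" where
  "rohlin_action G \<alpha> \<longleftrightarrow>
     (\<exists>e. (\<forall>g\<in>carrier G. e g \<in> central_sequences \<and> projection (e g)) \<and>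
          (\<forall>g\<in>carrier G. \<forall>h\<in>carrier G. g \<noteq> h \<longrightarrow> e g * e h = 0) \<and>
          (\<Sum>g\<in>carrier G. e g) = 1 \<and>
          (\<forall>g\<in>carrier G. \<forall>h\<in>carrier G. induced_map (\<alpha> g) (e h) = e (g \<otimes>\<^bsub>G\<^esub> h)))"

definition fixed_point_algebra ::
  "('g, 'b) monoid_scheme \<Rightarrow> ('g \<Rightarrow> 'a::unital_cstar_algebra \<Rightarrow> 'a) \<Rightarrow> 'a set" where
  "fixed_point_algebra G \<alpha> = {x. \<forall>g\<in>carrier G. \<alpha> g x = x}"

definition canonical_expectation ::
  "('g, 'b) monoid_scheme \<Rightarrow> ('g \<Rightarrow> 'a::unital_cstar_algebra \<Rightarrow> 'a) \<Rightarrow> 'a \<Rightarrow> 'a" where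
  "canonical_expectation G \<alpha> x = (1 / real (order G)) *\<^sub>R (\<Sum>g\<in>carrier G. \<alpha> g x)"

end

theory Submission
  imports Defs "HOL-Analysis.Elementary_Metric_Spaces"
begin

text \<open>
  Write \<open>N\<close> for the order of \<open>G\<close>. For a quasi-basis \<open>(u, v)\<close> put
  \<open>c g = (\<Sum>i. u i * \<alpha> g (v i))\<close>, so that \<open>Index E = c \<one>\<close>. Then
  \<open>(\<Sum>g. c g * \<alpha> g x) = N * x\<close> and \<open>x * c g = c g * \<alpha> g x\<close>, also for \<open>x\<close> in the sequence algebra,
  and the annihilator in \<open>A\<close> of a nonzero central sequence is \<open>0\<close> by simplicity.

  If \<open>\<alpha>\<close> has the Rohlin property with projections \<open>e g\<close>, then \<open>(e h, N e h)\<close> behaves like a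
  quasi-basis. Representatives give an approximate quasi-basis in \<open>A\<close>, and inverting an operator
  close to the identity makes it exact. The first identity at \<open>x = e \<one>\<close>, multiplied by \<open>e \<one>\<close>,
  gives \<open>(Index E - N) * e \<one> = 0\<close>, whence \<open>Index E = N\<close>.

  Conversely, let \<open>e\<close> be a Rohlin projection for \<open>E\<close>, \<open>f g = \<alpha> g e\<close> and \<open>z = Index E\<close>. The elements
  \<open>y g = c g * e - z * e * f g\<close> satisfy \<open>(\<Sum>g. y g * star (y g)) = N z e - 2 N z e + N z e = 0\<close>, so
  \<open>y g = 0\<close> by positivity. If \<open>c g \<noteq> 0\<close>, then \<open>c g * (f g - e) = 0\<close> forces \<open>f g = e\<close>, so
  \<open>c g = z\<close>, \<open>\<alpha> g = id\<close> and \<open>g = \<one>\<close>. For \<open>g \<noteq> \<one>\<close> therefore \<open>c g = 0\<close> and \<open>e * f g = 0\<close>; moreover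
  \<open>z = (\<Sum>g. c g) = N\<close>, so that the \<open>f g\<close> sum to \<open>1\<close>.
\<close>

section \<open>Positivity in C*-algebras\<close>

lemma star_zero [simp]: "star (0 :: 'a::complex_star_algebra_1) = 0"
  using star_add[of 0 "0::'a"] by simp

lemma star_one [simp]: "star (1 :: 'a::complex_star_algebra_1) = 1"
  using star_mult[of "star 1" "1::'a"] by (simp add: star_star)

lemma star_sum: "star (\<Sum>i\<in>I. f i) = (\<Sum>i\<in>I. star (f i :: 'a::complex_star_algebra_1))"
  by (induction I rule: infinite_finite_induct) (simp_all add: star_add)

lemma star_power: "star (x ^ n) = star (x :: 'a::complex_star_algebra_1) ^ n"
  by (induction n) (simp_all add: star_mult power_commutes)

lemma star_scaleR: "star (r *\<^sub>R x) = r *\<^sub>R star (x :: 'a::unital_cstar_algebra)"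
  by (simp add: scaleR_eq_scaleC star_scaleC)

lemma star_of_real [simp]: "star (of_real r :: 'a::unital_cstar_algebra) = of_real r"
  by (simp add: of_real_def star_scaleR)

lemma of_real_mult_commute: "of_real r * x = x * (of_real r :: 'a::real_algebra_1)"
  by (simp add: of_real_def)

lemma bounded_linear_star: "bounded_linear (star :: 'a::unital_cstar_algebra \<Rightarrow> 'a)"
  by (rule bounded_linear_intro[where K = 1]) (simp_all add: star_add star_scaleR norm_star)

lemma norm_star_mult_self: "norm (x * star x) = (norm (x :: 'a::unital_cstar_algebra))\<^sup>2"
  using cstar_identity[of "star x"] by (simp add: star_star norm_star)

lemma norm_square_self_adjoint:
  "star x = x \<Longrightarrow> norm (x * x) = (norm (x :: 'a::unital_cstar_algebra))\<^sup>2"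
  using cstar_identity[of x] by simp

text \<open>Here \<open>p + iq\<close> is unitary.\<close>

lemma norm_le_1_of_square_sum:
  fixes p q :: "'a::unital_cstar_algebra"
  assumes p: "star p = p" and q: "star q = q" and pq: "p * q = q * p" and 1: "p * p + q * q = 1"
  shows "norm p \<le> 1"
proof -
  define u where "u = p + \<i> *\<^sub>C q"
  have i: "(- \<i>) *\<^sub>C x = - (\<i> *\<^sub>C x)" for x :: 'a
    using scaleR_eq_scaleC[of "-1" "\<i> *\<^sub>C x"] by (simp add: scaleC_scaleC)
  have su: "star u = p - \<i> *\<^sub>C q"
    by (simp add: u_def star_add star_scaleC p q i)
  have "star u * u = p * p - (\<i> * \<i>) *\<^sub>C (q * q)"
    unfolding su unfolding u_def
    by (simp add: distrib_left left_diff_distrib mult_scaleC_left mult_scaleC_right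
        scaleC_diff_right scaleC_scaleC pq)
  also have "(\<i> * \<i>) *\<^sub>C (q * q) = - (q * q)"
    using scaleR_eq_scaleC[of "-1" "q * q"] by simp
  finally have "star u * u = 1" using 1 by simp
  then have nu: "norm u = 1"
    using cstar_identity[of u] norm_ge_zero[of u] by (auto simp: power2_eq_1_iff)
  have "2 *\<^sub>R p = u + star u" unfolding su by (simp add: u_def scaleR_2)
  then have "norm (2 *\<^sub>R p) \<le> norm u + norm (star u)"
    using norm_triangle_ineq[of u "star u"] by simp
  then have "2 * norm p \<le> norm u + norm (star u)" by simp
  then show ?thesis using nu by (simp add: norm_star)
qed

text \<open>Scaling \<open>p\<close> and \<open>q\<close> by \<open>1 / sqrt t\<close> reduces this
  to the preceding lemma.\<close>

lemma norm_square_le_of_square_sum: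
  fixes p q :: "'a::unital_cstar_algebra"
  assumes p: "star p = p" and q: "star q = q" and pq: "p * q = q * p"
    and 1: "p * p + q * q = of_real t" and t: "0 < t"
  shows "(norm p)\<^sup>2 \<le> t"
proof -
  define r where "r = 1 / sqrt t"
  have r: "r * r = 1 / t" "0 < r" using t by (auto simp: r_def)
  have "norm (r *\<^sub>R p) \<le> 1"
  proof (rule norm_le_1_of_square_sum[where q = "r *\<^sub>R q"])
    have "r *\<^sub>R p * r *\<^sub>R p + r *\<^sub>R q * r *\<^sub>R q = (r * r) *\<^sub>R (p * p + q * q)"
      by (simp add: algebra_simps)
    then show "r *\<^sub>R p * r *\<^sub>R p + r *\<^sub>R q * r *\<^sub>R q = 1"
      using 1 r t by (simp add: of_real_def)
  qed (simp_all add: star_scaleR p q pq)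
  then have "(r * norm p)\<^sup>2 \<le> 1" using r by (simp add: abs_square_le_1)
  moreover have "(r * norm p)\<^sup>2 = (norm p)\<^sup>2 / t"
    using r(1) by (simp only: power_mult_distrib power2_eq_square[of r] times_divide_eq_left mult_1)
  ultimately have "(norm p)\<^sup>2 / t \<le> 1" by simp
  then show ?thesis using t by (simp add: divide_le_eq)
qed

section \<open>Square roots by the binomial series\<close>

text \<open>These are the Taylor coefficients of sqrt(1 - y) at 0, written with rising
  factorials.\<close>

definition sqrt_coeff :: "nat \<Rightarrow> real" where
  "sqrt_coeff n = pochhammer (- 1 / 2) n / fact n"

text \<open>Dividing a power series by \<open>1 - y\<close> replaces its coefficients by their
  partial sums, and sqrt(1 - y) divided by \<open>1 - y\<close> is the binomial series with exponent
  -1/2, whose coefficients stand on the right.\<close>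

lemma sqrt_coeff_partial_sum: "(\<Sum>n\<le>N. sqrt_coeff n) = pochhammer (1 / 2) N / fact N"
proof (induction N)
  case (Suc N)
  define P :: real where "P = pochhammer (1 / 2) N / fact N"
  have "sqrt_coeff (Suc N) = - P / (2 * (1 + real N))"
    by (simp add: sqrt_coeff_def pochhammer_rec P_def)
  moreover have "pochhammer (1 / 2) (Suc N) / fact (Suc N) = P * (1 / 2 + real N) / (1 + real N)"
    by (simp add: pochhammer_Suc P_def)
  moreover have "P + - P / (2 * (1 + real N)) = P * (1 / 2 + real N) / (1 + real N)"
    by (simp add: field_simps)
  ultimately show ?case using Suc by (simp only: sum.atMost_Suc P_def[symmetric])
qed (simp add: sqrt_coeff_def)

lemma sqrt_coeff_Suc_nonpos: "sqrt_coeff (Suc n) \<le> 0"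
  by (simp add: sqrt_coeff_def pochhammer_rec pochhammer_nonneg divide_nonpos_pos
      del: fact_Suc)

text \<open>All coefficients after the leading \<open>1\<close> are nonpositive, so the absolute sum
  is \<open>1\<close> minus a partial sum, and partial sums are nonnegative.\<close>

lemma sum_abs_sqrt_coeff_Suc: "(\<Sum>n<N. \<bar>sqrt_coeff (Suc n)\<bar>) \<le> 1"
proof -
  have "(\<Sum>n<N. \<bar>sqrt_coeff (Suc n)\<bar>) = - (\<Sum>n<N. sqrt_coeff (Suc n))"
    using sqrt_coeff_Suc_nonpos by (simp add: abs_of_nonpos sum_negf)
  also have "\<dots> = 1 - (\<Sum>n\<le>N. sqrt_coeff n)"
    by (simp add: sum.atMost_shift sqrt_coeff_def)
  also have "\<dots> \<le> 1"
    unfolding sqrt_coeff_partial_sum by (simp add: pochhammer_nonneg)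
  finally show ?thesis .
qed

text \<open>The Vandermonde identity for rising factorials yields \<open>pochhammer (- 1) n\<close>,
  which vanishes from \<open>n = 2\<close> on: the formal square of the series is
  \<open>1 - y\<close>.\<close>

lemma sqrt_coeff_Cauchy_product:
  "(\<Sum>i\<le>n. sqrt_coeff i * sqrt_coeff (n - i)) = (if n = 0 then 1 else if n = 1 then -1 else 0)"
proof -
  have "(\<Sum>i\<le>n. sqrt_coeff i * sqrt_coeff (n - i)) =
      (\<Sum>i\<le>n. real (n choose i) * pochhammer (- 1 / 2) i * pochhammer (- 1 / 2) (n - i)) / fact n"
    unfolding sum_divide_distrib
  proof (intro sum.cong refl)
    fix i assume "i \<in> {..n}"
    then have "real (n choose i) = fact n / (fact i * fact (n - i))"
      by (simp add: binomial_fact)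
    then show "sqrt_coeff i * sqrt_coeff (n - i) =
        real (n choose i) * pochhammer (- 1 / 2) i * pochhammer (- 1 / 2) (n - i) / fact n"
      by (simp add: sqrt_coeff_def)
  qed
  also have "\<dots> = pochhammer (- 1) n / fact n"
    using pochhammer_binomial_sum[of "- 1 / 2 :: real" "- 1 / 2" n] by simp
  also have "\<dots> = (if n = 0 then 1 else if n = 1 then -1 else 0)"
    by (cases n; cases "n - 1") (auto simp: pochhammer_rec)
  finally show ?thesis .
qed

lemma summable_abs_sqrt_coeff: "summable (\<lambda>n. \<bar>sqrt_coeff n\<bar>)"
proof -
  have "summable (\<lambda>n. \<bar>sqrt_coeff (Suc n)\<bar>)"
    by (rule summableI_nonneg_bounded[where x = 1]) (simp_all add: sum_abs_sqrt_coeff_Suc)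
  then show ?thesis by (subst (asm) summable_Suc_iff)
qed

text \<open>For self-adjoint \<open>h\<close> the norm condition says that the spectrum lies in
  \<open>[0, 2 * t]\<close>. This form of positivity avoids spectral theory and makes sums of
  positive elements visibly positive.\<close>

definition positive :: "'a::unital_cstar_algebra \<Rightarrow> bool" where
  "positive h \<longleftrightarrow> star h = h \<and> (\<exists>t\<ge>0. norm (of_real t - h) \<le> t)"

text \<open>The binomial series converges absolutely even at norm \<open>1\<close>, because its
  coefficients are absolutely summable. As a limit of polynomials in \<open>y\<close>, its sum
  commutes with whatever commutes with \<open>y\<close>; the bound on \<open>1 - k\<close> makes
  \<open>k\<close> positive.\<close>

lemma binomial_sqrt:
  fixes y :: "'a::unital_cstar_algebra"
  assumes y: "star y = y" and ny: "norm y \<le> 1"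
  obtains k where "star k = k" "norm (1 - k) \<le> 1" "k * k = 1 - y"
    "\<And>x. x * y = y * x \<Longrightarrow> x * k = k * x"
proof -
  define a where "a n = sqrt_coeff n *\<^sub>R y ^ n" for n
  define k where "k = (\<Sum>n. a n)"
  have na: "norm (a n) \<le> \<bar>sqrt_coeff n\<bar>" for n
  proof -
    have "norm (y ^ n) \<le> 1"
      using norm_power_ineq[of y n] power_le_one[OF norm_ge_zero ny, of n] by linarith
    then show ?thesis by (simp add: a_def mult_left_le)
  qed
  have sn: "summable (\<lambda>n. norm (a n))"
    by (rule summable_comparison_test'[OF summable_abs_sqrt_coeff, of 0]) (simp add: na)
  then have sa: "summable a" by (rule summable_norm_cancel)
  have "star k = (\<Sum>n. star (a n))"
    unfolding k_def by (rule bounded_linear.suminf[OF bounded_linear_star sa])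
  then have k: "star k = k"
    by (simp add: a_def k_def star_scaleR star_power y)
  have comm: "x * k = k * x" if "x * y = y * x" for x
  proof -
    have "x * y ^ n = y ^ n * x" for n
      using power_commuting_commutes[of y x n] that by simp
    then have "x * a n = a n * x" for n by (simp add: a_def)
    then show ?thesis
      unfolding k_def by (simp add: suminf_mult[OF sa, symmetric] suminf_mult2[OF sa])
  qed
  have "(\<Sum>i\<le>n. a i * a (n - i)) = (if n = 0 then 1 else if n = 1 then - y else 0)" for n
  proof -
    have "(\<Sum>i\<le>n. a i * a (n - i)) = (\<Sum>i\<le>n. (sqrt_coeff i * sqrt_coeff (n - i)) *\<^sub>R y ^ n)"
      by (intro sum.cong refl) (simp add: a_def power_add[symmetric])
    also have "\<dots> = (if n = 0 then 1 else if n = 1 then -1 else 0 :: real) *\<^sub>R y ^ n"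
      by (simp only: scaleR_left.sum[symmetric] sqrt_coeff_Cauchy_product)
    finally show ?thesis by simp
  qed
  then have kk: "k * k = (\<Sum>n. if n = 0 then 1 else if n = 1 then - y else 0)"
    unfolding k_def by (simp add: Cauchy_product[OF sn sn])
  have "(\<lambda>n. if n = 0 then 1 else if n = 1 then - y else 0) sums
      (\<Sum>n\<in>{0::nat, 1}. if n = 0 then 1 else if n = 1 then - y else 0)"
    by (rule sums_finite) auto
  then have kk: "k * k = 1 - y" unfolding kk by (simp add: sums_iff)
  have "a 0 = 1" by (simp add: a_def sqrt_coeff_def)
  then have "(\<Sum>n. a (Suc n)) = k - 1"
    using suminf_split_head[OF sa] by (simp add: k_def)
  moreover have "norm (\<Sum>n. a (Suc n)) \<le> (\<Sum>n. \<bar>sqrt_coeff (Suc n)\<bar>)"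
  proof (rule norm_suminf_le)
    show "summable (\<lambda>n. \<bar>sqrt_coeff (Suc n)\<bar>)"
      using summable_abs_sqrt_coeff by (subst summable_Suc_iff)
  qed (rule na)
  moreover have "(\<Sum>n. \<bar>sqrt_coeff (Suc n)\<bar>) \<le> 1"
  proof (rule suminf_le_const)
    show "summable (\<lambda>n. \<bar>sqrt_coeff (Suc n)\<bar>)"
      using summable_abs_sqrt_coeff by (subst summable_Suc_iff)
  qed (rule sum_abs_sqrt_coeff_Suc)
  ultimately have "norm (1 - k) \<le> 1" by (simp add: norm_minus_commute)
  then show thesis using that[of k] k kk comm by blast
qed

section \<open>Order properties of positive elements\<close>

lemma positive_scaleR: "positive h \<Longrightarrow> 0 \<le> r \<Longrightarrow> positive (r *\<^sub>R h)"
proof -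
  assume h: "positive h" and r: "0 \<le> r"
  then obtain t where t: "0 \<le> t" "norm (of_real t - h) \<le> t" and sh: "star h = h"
    by (auto simp: positive_def)
  have "of_real (r * t) - r *\<^sub>R h = r *\<^sub>R (of_real t - h)"
    by (simp add: of_real_def scaleR_diff_right)
  then have "norm (of_real (r * t) - r *\<^sub>R h) \<le> r * t"
    using r t by (simp add: mult_left_mono)
  then show ?thesis
    using r t sh unfolding positive_def by (auto simp: star_scaleR intro!: exI[of _ "r * t"])
qed

text \<open>With a witness \<open>t > 0\<close> of positivity, \<open>h = t * (1 - y)\<close> where
  \<open>norm y \<le> 1\<close>, so the binomial series applies.\<close>

lemma positive_sqrt:
  assumes "positive h"
  obtains k where "positive k" "k * k = h" "\<And>x. x * h = h * x \<Longrightarrow> x * k = k * x"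
proof -
  obtain t where t: "0 \<le> t" "norm (of_real t - h) \<le> t" and sh: "star h = h"
    using assms by (auto simp: positive_def)
  show thesis
  proof (cases "t = 0")
    case True
    then have "h = 0" using t by simp
    then show thesis using assms by (intro that[of 0]) simp_all
  next
    case False
    define y where "y = 1 - (1 / t) *\<^sub>R h"
    have "y = (1 / t) *\<^sub>R (of_real t - h)"
      using False by (simp add: y_def of_real_def scaleR_diff_right)
    then have ny: "norm y \<le> 1" using t False by simp
    have "star y = y" by (simp add: y_def star_diff star_scaleR sh)
    from this ny obtain k where k: "star k = k" "norm (1 - k) \<le> 1" "k * k = 1 - y"
      "\<And>x. x * y = y * x \<Longrightarrow> x * k = k * x" by (rule binomial_sqrt) blast
    show thesis
    proof (rule that[of "sqrt t *\<^sub>R k"])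
      have "positive k" using k(1,2) unfolding positive_def by (auto intro!: exI[of _ 1])
      then show "positive (sqrt t *\<^sub>R k)" using t by (intro positive_scaleR) auto
      show "sqrt t *\<^sub>R k * sqrt t *\<^sub>R k = h" using t False by (simp add: k(3) y_def)
      show "x * sqrt t *\<^sub>R k = sqrt t *\<^sub>R k * x" if "x * h = h * x" for x
      proof -
        have "x * y = y * x" by (simp add: y_def left_diff_distrib right_diff_distrib that)
        then show ?thesis using k(4)[of x] by simp
      qed
    qed
  qed
qed

lemma positive_self_adjoint: "positive h \<Longrightarrow> star h = h"
  by (simp add: positive_def)

lemma positive_zero [simp]: "positive 0"
  by (auto simp: positive_def intro: exI[of _ 0])

lemma positive_add:
  assumes "positive a" "positive b"
  shows "positive (a + b)"
proof -
  obtain s t where "0 \<le> s" "norm (of_real s - a) \<le> s" "0 \<le> t" "norm (of_real t - b) \<le> t"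
    using assms by (auto simp: positive_def)
  then have "norm (of_real (s + t) - (a + b)) \<le> s + t"
    using norm_triangle_ineq[of "of_real s - a" "of_real t - b"] by (simp add: algebra_simps)
  with \<open>0 \<le> s\<close> \<open>0 \<le> t\<close> assms show ?thesis
    unfolding positive_def by (auto simp: star_add intro!: exI[of _ "s + t"])
qed

lemma positive_sum: "(\<And>i. i \<in> I \<Longrightarrow> positive (f i)) \<Longrightarrow> positive (\<Sum>i\<in>I. f i)"
  by (induction I rule: infinite_finite_induct) (simp_all add: positive_add)

lemma positive_norm_minus: "star h = h \<Longrightarrow> positive (of_real (norm h) - h)"
  unfolding positive_def by (auto simp: star_diff intro!: exI[of _ "norm h"])

text \<open>After normalising \<open>k\<close> to \<open>l\<close> of norm \<open>1\<close>, a root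
  \<open>q\<close> of \<open>1 - l * l\<close> commutes with \<open>l\<close> and the squares add up
  to \<open>1\<close>. Hence \<open>norm q \<le> 1\<close>, so \<open>1 - l * l\<close> has norm at
  most \<open>1\<close> and \<open>t = 1\<close> witnesses positivity.\<close>

lemma positive_square:
  fixes k :: "'a::unital_cstar_algebra"
  assumes k: "star k = k"
  shows "positive (k * k)"
proof (cases "k = 0")
  case False
  define l where "l = (1 / norm k) *\<^sub>R k"
  have l: "star l = l" "norm l = 1" using False k by (simp_all add: l_def star_scaleR)
  have "star (l * l) = l * l" "norm (l * l) \<le> 1"
    using l by (simp_all add: star_mult norm_square_self_adjoint)
  then obtain q where q: "star q = q" "q * q = 1 - l * l"
    and comm: "\<And>x. x * (l * l) = l * l * x \<Longrightarrow> x * q = q * x"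
    by (rule binomial_sqrt) blast
  have "l * q = q * l" by (rule comm) (simp add: mult.assoc)
  then have "norm q \<le> 1"
    using norm_le_1_of_square_sum[OF q(1) l(1)] q(2) by simp
  then have "norm (1 - l * l) \<le> 1"
    using norm_square_self_adjoint[OF q(1)] q(2) by (simp add: power_le_one)
  then have "positive (l * l)"
    unfolding positive_def using l by (auto simp: star_mult intro!: exI[of _ 1])
  then have "positive ((norm k)\<^sup>2 *\<^sub>R (l * l))" by (rule positive_scaleR) simp
  then show ?thesis using False by (simp add: l_def power2_eq_square)
qed simp

text \<open>Commuting roots \<open>p\<close> of \<open>h\<close> and \<open>q\<close> of the
  complement have squares adding up to a scalar, which bounds the square of \<open>norm p\<close>,
  that is \<open>norm h\<close>.\<close>

lemma norm_le_of_positive: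
  fixes h :: "'a::unital_cstar_algebra"
  assumes h: "positive h" and th: "positive (of_real t - h)" and t: "0 \<le> t"
  shows "norm h \<le> t"
proof (rule field_le_epsilon)
  \<comment> \<open>The bound on square sums requires a positive scalar, whereas \<open>t\<close>
    may be \<open>0\<close>.\<close>
  fix e :: real assume e: "0 < e"
  have "positive (of_real e :: 'a)"
    using e by (auto simp: positive_def intro!: exI[of _ e])
  from positive_add[OF th this] have th: "positive (of_real (t + e) - h)"
    by (simp add: algebra_simps)
  obtain p where p: "positive p" "p * p = h"
    using positive_sqrt[OF h] by blast
  obtain q where q: "positive q" "q * q = of_real (t + e) - h"
    and qc: "\<And>x. x * (of_real (t + e) - h) = (of_real (t + e) - h) * x \<Longrightarrow> x * q = q * x"
    using positive_sqrt[OF th] by blast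
  have "h * p = p * h" by (simp add: p(2)[symmetric] mult.assoc)
  then have "p * q = q * p"
    by (intro qc) (simp add: algebra_simps of_real_mult_commute)
  moreover have pq: "star p = p" "star q = q" using p q by (simp_all add: positive_self_adjoint)
  moreover have sum: "p * p + q * q = of_real (t + e)" by (simp add: p q)
  ultimately have "(norm p)\<^sup>2 \<le> t + e"
    using t e by (intro norm_square_le_of_square_sum[of p q]) simp_all
  moreover have "norm h = (norm p)\<^sup>2" using norm_square_self_adjoint[OF pq(1)] p by simp
  ultimately show "norm h \<le> t + e" by simp
qed

lemma positive_of_real_diff: "star h = h \<Longrightarrow> norm h \<le> t \<Longrightarrow> positive (of_real t - h)"
  using norm_ge_zero[of h] unfolding positive_def
  by (auto simp: star_diff simp del: norm_ge_zero intro!: exI[of _ t])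

text \<open>In the order of positive elements, \<open>a\<close> lies below \<open>a + b\<close>,
  which lies below the scalar \<open>norm (a + b)\<close>.\<close>

lemma norm_mono_positive:
  assumes "positive a" "positive b"
  shows "norm a \<le> norm (a + b)"
proof (rule norm_le_of_positive)
  have "positive (of_real (norm (a + b)) - (a + b))"
    using assms by (intro positive_norm_minus) (simp add: star_add positive_self_adjoint)
  from positive_add[OF this assms(2)] show "positive (of_real (norm (a + b)) - a)" by simp
qed (simp_all add: assms)

section \<open>Positivity of \<open>star x * x\<close>\<close>

text \<open>The next lemma excludes \<open>star y * y = - b\<close> with \<open>0 \<noteq> b \<ge> 0\<close>: then \<open>y * star y\<close> would be
  positive of norm \<open>M = norm b\<close>, so that \<open>y' = M y - (y * star y) * y = y * (M + b)\<close> would satisfy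
  \<open>norm y' \<le> M * norm y\<close>, whereas \<open>star y' * y'\<close> is too large.\<close>

lemma star_mult_self_negative:
  fixes y s :: "'a::unital_cstar_algebra"
  assumes s: "star s = s" and y: "star y * y = - (s * s)"
  shows "y = 0"
proof (rule ccontr)
  assume "y \<noteq> 0"
  define b a M where "b = s * s" and "a = y * star y" and "M = norm b"
  have yb: "star y * y = - b" and sb: "star b = b" and pb: "positive b"
    using y s by (simp_all add: b_def star_mult positive_square)
  have M: "M = (norm y)\<^sup>2" using cstar_identity[of y] yb by (simp add: M_def)
  with \<open>y \<noteq> 0\<close> have M0: "0 < M" by simp
  have na: "norm a = M" unfolding a_def M by (rule norm_star_mult_self)
  \<comment> \<open>Up to sign these are twice the real and imaginary parts of \<open>y\<close>;
    their squares exhibit \<open>a\<close> as a positive element.\<close>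
  define p q where "p = y + star y" and "q = \<i> *\<^sub>C (y - star y)"
  have "star p = p" by (simp add: p_def star_add star_star add.commute)
  have "star q = - (\<i> *\<^sub>C (star y - y))"
    using scaleR_eq_scaleC[of "-1" "\<i> *\<^sub>C (star y - y)"]
    by (simp add: q_def star_diff star_scaleC star_star scaleC_scaleC)
  also have "\<dots> = q" by (simp add: q_def scaleC_diff_right)
  finally have "star q = q" .
  have "p * p + q * q = 2 *\<^sub>R (star y * y + y * star y)"
  proof -
    have "q * q = (\<i> * \<i>) *\<^sub>C ((y - star y) * (y - star y))"
      by (simp only: q_def mult_scaleC_left mult_scaleC_right scaleC_scaleC)
    also have "\<dots> = - ((y - star y) * (y - star y))"
      using scaleR_eq_scaleC[of "-1" "(y - star y) * (y - star y)"] by simp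
    finally show ?thesis by (simp add: p_def algebra_simps scaleR_2)
  qed
  then have "a = (1 / 2) *\<^sub>R (p * p + q * q) + b"
    by (simp add: a_def yb)
  then have pa: "positive a"
    using positive_add[OF positive_scaleR[OF positive_add[OF
      positive_square[OF \<open>star p = p\<close>] positive_square[OF \<open>star q = q\<close>]], of "1 / 2"] pb]
    by simp
  have "norm (of_real M - a) \<le> M"
  proof (rule norm_le_of_positive)
    show "positive (of_real M - a)"
      using na by (intro positive_of_real_diff positive_self_adjoint pa) simp
  qed (use pa M0 in simp_all)
  define y' where "y' = (of_real M - a) * y"
  have "a * y = - (y * b)" by (simp add: a_def mult.assoc yb)
  then have y': "y' = y * (of_real M + b)"
    by (simp add: y'_def left_diff_distrib distrib_left of_real_def)
  have "norm y' \<le> M * norm y"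
    unfolding y'_def using norm_mult_ineq[of "of_real M - a" y] \<open>norm (of_real M - a) \<le> M\<close>
    by (meson mult_right_mono norm_ge_zero order_trans)
  then have "(norm y')\<^sup>2 \<le> M\<^sup>2 * M"
    using power_mono[of "norm y'" "M * norm y" 2] by (simp add: power_mult_distrib M)
  \<comment> \<open>Since \<open>s * s = b\<close> and everything commutes, \<open>r * r\<close> is
    \<open>b\<close> times the square of \<open>M + b\<close>.\<close>
  define r where "r = (of_real M + b) * s"
  have bs: "b * s = s * b" by (simp add: b_def mult.assoc)
  have sr: "star r = r"
    by (simp add: r_def star_mult star_add s sb distrib_left distrib_right of_real_def star_scaleR bs)
  have "star y' * y' = (of_real M + b) * star y * (y * (of_real M + b))"
    by (simp add: y' star_mult star_add sb)
  also have "\<dots> = (of_real M + b) * (star y * y) * (of_real M + b)"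
    by (simp only: mult.assoc)
  also have "\<dots> = - (r * r)"
    unfolding yb by (simp add: r_def of_real_def algebra_simps bs b_def)
  finally have "norm (r * r) \<le> M\<^sup>2 * M"
    using cstar_identity[of y'] \<open>(norm y')\<^sup>2 \<le> M\<^sup>2 * M\<close> by simp
  then have "positive (of_real (M\<^sup>2 * M) - r * r)"
    by (intro positive_of_real_diff) (simp_all add: star_mult sr)
  \<comment> \<open>This summand, the cube of \<open>b\<close>, cancels the cubic term of
    \<open>r * r\<close>; the next one cancels the quadratic term. What remains bounds
    \<open>5 * b\<close> by the scalar \<open>3 * M\<close>, which contradicts
    \<open>norm b = M\<close>.\<close>
  moreover have "positive (b * s * (b * s))"
    by (intro positive_square) (simp add: star_mult s sb bs)
  moreover have "positive ((2 * M) *\<^sub>R ((of_real M - b) * (of_real M - b)))"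
    using M0 by (intro positive_scaleR positive_square) (simp_all add: star_diff sb)
  ultimately have "positive (of_real (M\<^sup>2 * M) - r * r + b * s * (b * s)
      + (2 * M) *\<^sub>R ((of_real M - b) * (of_real M - b)))"
    by (intro positive_add)
  also have "of_real (M\<^sup>2 * M) - r * r + b * s * (b * s)
      + (2 * M) *\<^sub>R ((of_real M - b) * (of_real M - b)) =
      of_real (3 * M ^ 3) - (5 * M\<^sup>2) *\<^sub>R b"
  proof -
    have "r * r = (M * M) *\<^sub>R b + (M *\<^sub>R (b * b) + M *\<^sub>R (b * b)) + b * s * (b * s)"
      by (simp add: r_def of_real_def algebra_simps b_def)
    moreover have "(of_real M - b) * (of_real M - b) = (M * M) *\<^sub>R 1 - (M *\<^sub>R b + M *\<^sub>R b) + b * b"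
      by (simp add: of_real_def algebra_simps)
    ultimately show ?thesis
      by (simp add: of_real_def power2_eq_square power3_eq_cube scaleR_diff_right scaleR_add_right)
        (simp add: scaleR_left_distrib[symmetric] algebra_simps)
  qed
  finally have "positive (of_real (3 * M ^ 3) - (5 * M\<^sup>2) *\<^sub>R b)" .
  moreover have "positive ((5 * M\<^sup>2) *\<^sub>R b)" by (intro positive_scaleR pb) simp
  ultimately have "norm ((5 * M\<^sup>2) *\<^sub>R b) \<le> 3 * M ^ 3"
    using M0 by (intro norm_le_of_positive) simp_all
  then show False using M0 by (simp add: M_def[symmetric] power2_eq_square power3_eq_cube)
qed

text \<open>Here \<open>d\<close> is the absolute value of \<open>h\<close>, and
  \<open>f = d - h\<close> is twice its negative part. Since \<open>h * f = - (d * f)\<close>, the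
  element \<open>star (x * f) * (x * f)\<close> is minus a square, so the preceding lemma gives
  \<open>x * f = 0\<close>. Then \<open>f * f = 0\<close>, and \<open>h = d\<close> is
  positive.\<close>

lemma positive_star_mult_self:
  fixes x :: "'a::unital_cstar_algebra"
  shows "positive (star x * x)"
proof -
  define h where "h = star x * x"
  have sh: "star h = h" by (simp add: h_def star_mult star_star)
  obtain d where d: "positive d" "d * d = h * h" and dc: "\<And>z. z * (h * h) = h * h * z \<Longrightarrow> z * d = d * z"
    using positive_sqrt[OF positive_square[OF sh]] by blast
  obtain m where m: "positive m" "m * m = d" and mc: "\<And>z. z * d = d * z \<Longrightarrow> z * m = m * z"
    using positive_sqrt[OF d(1)] by blast
  note sd = positive_self_adjoint[OF d(1)] and sm = positive_self_adjoint[OF m(1)]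
  have hd: "h * d = d * h" by (rule dc) (simp add: mult.assoc)
  then have hm: "h * m = m * h" by (rule mc)
  have dm: "d * m = m * d" by (simp add: m(2)[symmetric] mult.assoc)
  define f where "f = d - h"
  have sf: "star f = f" by (simp add: f_def star_diff sd sh)
  have fm: "f * m = m * f" by (simp add: f_def left_diff_distrib right_diff_distrib hm dm)
  have fd: "f * d = d * f" by (simp add: f_def left_diff_distrib right_diff_distrib hd)
  have hf: "h * f = - (d * f)" by (simp add: f_def right_diff_distrib hd d(2))
  have "star (x * f) * (x * f) = f * (h * f)"
    by (simp add: star_mult sf h_def mult.assoc)
  also have "\<dots> = - (f * m * (m * f))" by (simp add: hf m(2)[symmetric] mult.assoc)
  finally have "x * f = 0"
    by (intro star_mult_self_negative[of "m * f"]) (simp_all add: star_mult sf sm fm)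
  then have "h * f = 0" by (simp add: h_def mult.assoc)
  then have "f * f = 0" using hf by (simp add: f_def left_diff_distrib)
  then have "f = 0" using norm_square_self_adjoint[OF sf] by simp
  then show ?thesis using d(1) by (simp add: f_def h_def)
qed

lemma norm_mult_star_le_sum:
  fixes x :: "'i \<Rightarrow> 'a::unital_cstar_algebra"
  assumes "finite I" "i \<in> I"
  shows "(norm (x i))\<^sup>2 \<le> norm (\<Sum>j\<in>I. x j * star (x j))"
proof -
  have pos: "positive (y * star y)" for y :: 'a
    using positive_star_mult_self[of "star y"] by (simp add: star_star)
  have "norm (x i * star (x i)) \<le> norm (x i * star (x i) + (\<Sum>j\<in>I - {i}. x j * star (x j)))"
    by (intro norm_mono_positive positive_sum pos)
  then show ?thesis using assms by (simp add: sum.remove norm_star_mult_self)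
qed

section \<open>Automorphisms are contractive\<close>

lemma star_automorphism_add: "star_automorphism \<phi> \<Longrightarrow> \<phi> (x + y) = \<phi> x + \<phi> y"
  and star_automorphism_mult: "star_automorphism \<phi> \<Longrightarrow> \<phi> (x * y) = \<phi> x * \<phi> y"
  and star_automorphism_star: "star_automorphism \<phi> \<Longrightarrow> \<phi> (star x) = star (\<phi> x)"
  and star_automorphism_scaleC: "star_automorphism \<phi> \<Longrightarrow> \<phi> (c *\<^sub>C x) = c *\<^sub>C \<phi> x"
  by (simp_all add: star_automorphism_def complex_linear_def)

lemma star_automorphism_scaleR: "star_automorphism \<phi> \<Longrightarrow> \<phi> (r *\<^sub>R x) = r *\<^sub>R \<phi> x"
  by (simp add: scaleR_eq_scaleC star_automorphism_scaleC)

lemma star_automorphism_zero: "star_automorphism \<phi> \<Longrightarrow> \<phi> 0 = 0"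
  using star_automorphism_scaleR[of \<phi> 0 0] by simp

lemma star_automorphism_minus: "star_automorphism \<phi> \<Longrightarrow> \<phi> (- x) = - \<phi> x"
  using star_automorphism_scaleR[of \<phi> "-1" x] by simp

lemma star_automorphism_diff: "star_automorphism \<phi> \<Longrightarrow> \<phi> (x - y) = \<phi> x - \<phi> y"
  using star_automorphism_add[of \<phi> x "- y"] by (simp add: star_automorphism_minus)

lemma star_automorphism_one:
  assumes "star_automorphism \<phi>"
  shows "\<phi> 1 = 1"
proof -
  obtain x where "\<phi> x = 1" using assms by (auto simp: star_automorphism_def bij_def surj_def) metis
  then show ?thesis using star_automorphism_mult[OF assms, of 1 x] by simp
qed

text \<open>If \<open>norm x \<le> 1\<close> and \<open>h = star x * x\<close>, then \<open>1 - h\<^sup>2\<close> is the square of a self-adjoint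
  element commuting with \<open>h\<close>, and this is preserved by \<open>\<phi>\<close>.\<close>

lemma norm_star_automorphism_le:
  fixes \<phi> :: "'a::unital_cstar_algebra \<Rightarrow> 'a"
  assumes \<phi>: "star_automorphism \<phi>"
  shows "norm (\<phi> x) \<le> norm x"
proof (cases "x = 0")
  case False
  define y where "y = (1 / norm x) *\<^sub>R x"
  define h where "h = star y * y"
  have "norm y = 1" using False by (simp add: y_def)
  then have h: "star h = h" "norm h = 1"
    by (simp_all add: h_def star_mult star_star cstar_identity)
  then have "star (h * h) = h * h" "norm (h * h) \<le> 1"
    by (simp_all add: star_mult norm_square_self_adjoint)
  then obtain k where k: "star k = k" "k * k = 1 - h * h"
    and comm: "\<And>z. z * (h * h) = h * h * z \<Longrightarrow> z * k = k * z"
    by (rule binomial_sqrt) blast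
  have hk: "h * k = k * h" by (rule comm) (simp add: mult.assoc)
  have "norm (\<phi> h) \<le> 1"
  proof (rule norm_le_1_of_square_sum)
    show "star (\<phi> h) = \<phi> h" "star (\<phi> k) = \<phi> k"
      by (simp_all add: star_automorphism_star[OF \<phi>, symmetric] h k)
    show "\<phi> h * \<phi> k = \<phi> k * \<phi> h"
      by (simp add: star_automorphism_mult[OF \<phi>, symmetric] hk)
    show "\<phi> h * \<phi> h + \<phi> k * \<phi> k = 1"
      by (simp add: star_automorphism_mult[OF \<phi>, symmetric] star_automorphism_add[OF \<phi>, symmetric]
          k star_automorphism_one[OF \<phi>])
  qed
  moreover have "\<phi> h = star (\<phi> y) * \<phi> y"
    by (simp add: h_def star_automorphism_mult[OF \<phi>] star_automorphism_star[OF \<phi>])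
  ultimately have "norm (\<phi> y) \<le> 1" by (simp add: cstar_identity abs_square_le_1)
  then show ?thesis using False by (simp add: y_def star_automorphism_scaleR[OF \<phi>] divide_le_eq)
qed (simp add: star_automorphism_zero[OF \<phi>])

lemma star_automorphism_bounded_linear: "star_automorphism \<phi> \<Longrightarrow> bounded_linear \<phi>"
  by (rule bounded_linear_intro[where K = 1])
    (simp_all add: star_automorphism_add star_automorphism_scaleR norm_star_automorphism_le)

section \<open>The sequence algebra\<close>

lemma Bseq_rep_seqalg: "Bseq (rep_seqalg x)"
  using Quotient3_rep_reflp[OF Quotient3_seqalg, of x] by (simp add: seq_eq_def)

lemma abs_rep_seqalg: "abs_seqalg (rep_seqalg x) = x"
  by (rule Quotient3_abs_rep[OF Quotient3_seqalg])

lemma abs_seqalg_eq_0_iff: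
  assumes "Bseq f"
  shows "abs_seqalg f = 0 \<longleftrightarrow> f \<longlonglongrightarrow> (0 :: 'a::unital_cstar_algebra)"
proof -
  have "abs_seqalg f = 0 \<longleftrightarrow> seq_eq f (\<lambda>_. 0)"
    unfolding zero_seqalg_def map_fun_def id_apply
    using Quotient3_rel[OF Quotient3_seqalg, of f "\<lambda>_. 0"] assms by (simp add: seq_eq_def)
  then show ?thesis using assms by (simp add: seq_eq_def tendsto_norm_zero_iff)
qed

lemma abs_seqalg_plus:
  "Bseq f \<Longrightarrow> Bseq g \<Longrightarrow> abs_seqalg f + abs_seqalg g = abs_seqalg (\<lambda>n. f n + g n)"
  by (simp add: plus_seqalg.abs_eq seqalg_Bseq)

lemma abs_seqalg_times:
  "Bseq f \<Longrightarrow> Bseq g \<Longrightarrow> abs_seqalg f * abs_seqalg g = abs_seqalg (\<lambda>n. f n * g n)"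
  by (simp add: times_seqalg.abs_eq seqalg_Bseq)

lemma abs_seqalg_star: "Bseq f \<Longrightarrow> star (abs_seqalg f) = abs_seqalg (\<lambda>n. star (f n))"
  by (simp add: star_seqalg.abs_eq seqalg_Bseq)

lemma abs_seqalg_uminus: "Bseq f \<Longrightarrow> - abs_seqalg f = abs_seqalg (\<lambda>n. - f n)"
  by (simp add: uminus_seqalg.abs_eq seqalg_Bseq)

lemma abs_seqalg_minus:
  "Bseq f \<Longrightarrow> Bseq g \<Longrightarrow> abs_seqalg f - abs_seqalg g = abs_seqalg (\<lambda>n. f n - g n)"
  using abs_seqalg_plus[of f "\<lambda>n. - g n"] abs_seqalg_uminus[of g]
  by (simp add: Bseq_minus_iff minus_seqalg_def)

lemma abs_seqalg_const: "abs_seqalg (\<lambda>_. a) = const_seq a"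
  by (simp add: const_seq_def)

lemma Bseq_sum:
  fixes f :: "'i \<Rightarrow> nat \<Rightarrow> 'a::real_normed_vector"
  shows "(\<And>i. i \<in> I \<Longrightarrow> Bseq (f i)) \<Longrightarrow> Bseq (\<lambda>n. \<Sum>i\<in>I. f i n)"
  by (induction I rule: infinite_finite_induct) (simp_all add: Bseq_add_alg)

lemma abs_seqalg_sum:
  fixes f :: "'i \<Rightarrow> nat \<Rightarrow> 'a::unital_cstar_algebra"
  shows "(\<And>i. i \<in> I \<Longrightarrow> Bseq (f i)) \<Longrightarrow> (\<Sum>i\<in>I. abs_seqalg (f i)) = abs_seqalg (\<lambda>n. \<Sum>i\<in>I. f i n)"
  by (induction I rule: infinite_finite_induct)
    (simp_all add: abs_seqalg_plus Bseq_sum zero_seqalg_def)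

lemma const_seq_0 [simp]: "const_seq 0 = 0"
  and const_seq_1 [simp]: "const_seq 1 = 1"
  and const_seq_add: "const_seq (a + b) = const_seq a + const_seq b"
  and const_seq_mult: "const_seq (a * b) = const_seq a * const_seq b"
  and const_seq_star: "const_seq (star a) = star (const_seq a)"
  and const_seq_uminus: "const_seq (- a) = - const_seq a"
  by (simp_all add: abs_seqalg_const[symmetric] zero_seqalg_def one_seqalg_def abs_seqalg_plus
      abs_seqalg_times abs_seqalg_star abs_seqalg_uminus)

lemma const_seq_diff: "const_seq (a - b) = const_seq a - const_seq b"
  using const_seq_add[of a "- b"] by (simp add: const_seq_uminus)

lemma const_seq_sum: "const_seq (\<Sum>i\<in>I. f i) = (\<Sum>i\<in>I. const_seq (f i))"
  by (induction I rule: infinite_finite_induct) (simp_all add: const_seq_add)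

lemma const_seq_of_nat [simp]: "const_seq (of_nat n) = of_nat n"
  by (induction n) (simp_all add: const_seq_add)

lemma const_seq_of_bool [simp]: "const_seq (of_bool b) = of_bool b"
  by (cases b) simp_all

section \<open>Positivity and annihilators in the sequence algebra\<close>

text \<open>The sequence algebra carries no norm here, so \<open>norm_mult_star_le_sum\<close> is
  applied to each term of representatives before passing to the limit.\<close>

lemma seqalg_eq_0_if_sum_mult_star_eq_0:
  fixes x :: "'i \<Rightarrow> 'a::unital_cstar_algebra seqalg"
  assumes "finite I" "i \<in> I" and 0: "(\<Sum>j\<in>I. x j * star (x j)) = 0"
  shows "x i = 0"
proof -
  define f where "f j = rep_seqalg (x j)" for j
  have x: "x j = abs_seqalg (f j)" and B: "Bseq (f j)" for j
    by (simp_all add: f_def abs_rep_seqalg Bseq_rep_seqalg)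
  have "(\<Sum>j\<in>I. x j * star (x j)) = abs_seqalg (\<lambda>n. \<Sum>j\<in>I. f j n * star (f j n))"
    by (simp add: x B abs_seqalg_star abs_seqalg_times Bseq_star Bseq_mult_alg abs_seqalg_sum)
  with 0 have lim: "(\<lambda>n. \<Sum>j\<in>I. f j n * star (f j n)) \<longlonglongrightarrow> 0"
    by (simp add: abs_seqalg_eq_0_iff Bseq_sum Bseq_mult_alg Bseq_star B)
  have "(\<lambda>n. (norm (f i n))\<^sup>2) \<longlonglongrightarrow> 0"
    by (rule tendsto_sandwich[OF _ _ tendsto_const tendsto_norm_zero[OF lim]])
      (simp_all add: norm_mult_star_le_sum[OF assms(1,2), of "\<lambda>j. f j _"])
  then have "(\<lambda>n. norm (f i n)) \<longlonglongrightarrow> 0"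
    using tendsto_real_sqrt[of "\<lambda>n. (norm (f i n))\<^sup>2" 0 sequentially] by simp
  then show ?thesis
    by (simp add: x abs_seqalg_eq_0_iff B tendsto_norm_zero_iff)
qed

text \<open>A representative \<open>f\<close> of \<open>t\<close> is bounded, so replacing
  \<open>a\<close> by a nearby element changes \<open>a * f n\<close> by little, uniformly in
  \<open>n\<close>.\<close>

lemma closed_annihilator:
  fixes t :: "'a::unital_cstar_algebra seqalg"
  shows "closed {a. const_seq a * t = 0}"
proof -
  define f where "f = rep_seqalg t"
  have t: "t = abs_seqalg f" and B: "Bseq f"
    by (simp_all add: f_def abs_rep_seqalg Bseq_rep_seqalg)
  have "const_seq a * t = abs_seqalg (\<lambda>n. a * f n)" for a
    by (simp add: t abs_seqalg_const[symmetric] abs_seqalg_times B)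
  then have iff: "const_seq a * t = 0 \<longleftrightarrow> (\<lambda>n. a * f n) \<longlonglongrightarrow> 0" for a
    by (simp add: abs_seqalg_eq_0_iff Bseq_mult_alg B)
  obtain M where M: "0 < M" "\<And>n. norm (f n) \<le> M" using B by (metis BseqE)
  show ?thesis
    unfolding closed_sequential_limits
  proof safe
    fix b l assume b: "\<forall>k. b k \<in> {a. const_seq a * t = 0}" and bl: "b \<longlonglongrightarrow> l"
    have "(\<lambda>n. l * f n) \<longlonglongrightarrow> 0"
    proof (rule LIMSEQ_I)
      fix r :: real assume r: "0 < r"
      obtain k where k: "norm (b k - l) < r / (2 * M)"
        using LIMSEQ_D[OF bl, of "r / (2 * M)"] r M by fastforce
      have "(\<lambda>n. b k * f n) \<longlonglongrightarrow> 0" using b iff by simp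
      then obtain n0 where n0: "\<And>n. n \<ge> n0 \<Longrightarrow> norm (b k * f n) < r / 2"
        using LIMSEQ_D[of _ 0 "r / 2"] r by fastforce
      have "norm (l * f n) < r" if "n \<ge> n0" for n
      proof -
        have "norm ((b k - l) * f n) \<le> r / (2 * M) * M"
          using k M by (intro order_trans[OF norm_mult_ineq] mult_mono) (use r in auto)
        then have "norm ((b k - l) * f n) \<le> r / 2" using M by simp
        moreover have "l * f n = b k * f n - (b k - l) * f n" by (simp add: algebra_simps)
        ultimately show ?thesis
          using n0[OF that] norm_triangle_ineq4[of "b k * f n" "(b k - l) * f n"] by simp
      qed
      then show "\<exists>n0. \<forall>n\<ge>n0. norm (l * f n - 0) < r" by auto
    qed
    then show "const_seq l * t = 0" by (simp add: iff)
  qed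
qed

lemma central_sequences_commute:
  "t \<in> central_sequences \<Longrightarrow> t * const_seq a = const_seq a * t"
  by (simp add: central_sequences_def)

text \<open>The annihilator of a central sequence is a closed ideal.\<close>

lemma const_seq_mult_central_eq_0:
  fixes t :: "'a::unital_cstar_algebra seqalg"
  assumes "simple_cstar_algebra TYPE('a)" and t: "t \<in> central_sequences"
    and "const_seq a * t = 0"
  shows "a = 0 \<or> t = 0"
proof -
  let ?I = "{a. const_seq a * t = 0}"
  have "const_seq (c *\<^sub>C x) * t = 0" if "const_seq x * t = 0" for c and x :: 'a
    using that const_seq_mult[of "c *\<^sub>C 1" x] by (simp add: mult_scaleC_left mult.assoc)
  moreover have "const_seq (x * b) * t = 0" if "const_seq x * t = 0" for x b
    using that central_sequences_commute[OF t, of b, symmetric]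
    by (simp add: const_seq_mult mult.assoc) (simp add: mult.assoc[symmetric])
  ultimately have "closed_ideal ?I"
    by (auto simp: closed_ideal_def closed_annihilator const_seq_add const_seq_mult
        distrib_right mult.assoc)
  then have "?I = {0} \<or> ?I = UNIV" using assms(1) by (simp add: simple_cstar_algebra_def)
  then have "?I = {0} \<or> 1 \<in> ?I" by blast
  then show ?thesis using assms(3) by auto
qed

section \<open>Maps induced termwise by automorphisms\<close>

lemma Bseq_bounded_linear:
  assumes T: "bounded_linear T" and "Bseq f"
  shows "Bseq (\<lambda>n. T (f n))"
proof -
  obtain K where K: "\<And>n. norm (f n) \<le> K" using assms(2) by (metis BseqE)
  obtain M where M: "0 < M" "\<And>x. norm (T x) \<le> norm x * M"
    using bounded_linear.pos_bounded[OF T] by blast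
  have "norm (T (f n)) \<le> K * M" for n
    using K M by (intro order_trans[OF M(2)] mult_right_mono) auto
  then show ?thesis by (rule BseqI')
qed

context
  fixes \<phi> :: "'a::unital_cstar_algebra \<Rightarrow> 'a"
  assumes \<phi>: "star_automorphism \<phi>"
begin

private lemma Bseq_aut: "Bseq f \<Longrightarrow> Bseq (\<lambda>n. \<phi> (f n))"
  by (rule Bseq_bounded_linear[OF star_automorphism_bounded_linear[OF \<phi>]])

private lemma induced_abs: "Bseq f \<Longrightarrow> induced_map \<phi> (abs_seqalg f) = abs_seqalg (\<lambda>n. \<phi> (f n))"
  by (rule induced_map_abs[OF star_automorphism_bounded_linear[OF \<phi>]])

lemma induced_map_const: "induced_map \<phi> (const_seq a) = const_seq (\<phi> a)"
  unfolding abs_seqalg_const[symmetric] by (rule induced_abs) simp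

lemma induced_map_mult: "induced_map \<phi> (x * y) = induced_map \<phi> x * induced_map \<phi> y"
proof -
  have "induced_map \<phi> (abs_seqalg f * abs_seqalg g) =
      induced_map \<phi> (abs_seqalg f) * induced_map \<phi> (abs_seqalg g)" if "Bseq f" "Bseq g" for f g
    using that by (simp add: induced_abs abs_seqalg_times Bseq_mult_alg Bseq_aut
        star_automorphism_mult[OF \<phi>])
  from this[OF Bseq_rep_seqalg Bseq_rep_seqalg, of x y] show ?thesis by (simp add: abs_rep_seqalg)
qed

lemma induced_map_star: "induced_map \<phi> (star x) = star (induced_map \<phi> x)"
proof -
  have "induced_map \<phi> (star (abs_seqalg f)) = star (induced_map \<phi> (abs_seqalg f))" if "Bseq f" for f
    using that by (simp add: induced_abs abs_seqalg_star Bseq_star Bseq_aut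
        star_automorphism_star[OF \<phi>])
  from this[OF Bseq_rep_seqalg, of x] show ?thesis by (simp add: abs_rep_seqalg)
qed

lemma induced_map_comp:
  "star_automorphism \<psi> \<Longrightarrow> induced_map \<psi> (induced_map \<phi> x) = induced_map (\<psi> \<circ> \<phi>) x"
  unfolding induced_map_def[of \<phi>] induced_map_def[of "\<psi> \<circ> \<phi>"]
  by (simp add: induced_map_abs star_automorphism_bounded_linear Bseq_aut Bseq_rep_seqalg)

lemma induced_map_zero: "induced_map \<phi> 0 = 0"
  using induced_map_const[of 0] by (simp add: star_automorphism_zero[OF \<phi>])

lemma induced_map_central:
  assumes "x \<in> central_sequences"
  shows "induced_map \<phi> x \<in> central_sequences"
  unfolding central_sequences_def
proof safe
  fix a
  \<comment> \<open>Centrality is tested against all of the algebra, and every element is an image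
    by surjectivity.\<close>
  obtain b where "a = \<phi> b" using \<phi> by (metis star_automorphism_def bij_def surjD)
  then show "induced_map \<phi> x * const_seq a = const_seq a * induced_map \<phi> x"
    using central_sequences_commute[OF assms, of b]
    by (simp add: induced_map_const[symmetric] induced_map_mult[symmetric])
qed

lemma induced_map_projection: "projection x \<Longrightarrow> projection (induced_map \<phi> x)"
  by (simp add: projection_def induced_map_mult[symmetric] induced_map_star[symmetric])

end

section \<open>Inverting additive maps near the identity\<close>

text \<open>\<open>S x = y\<close> says that \<open>x\<close> is a fixed point of \<open>\<lambda>x. y - (S x - x)\<close>.\<close>

lemma bij_if_near_identity:
  fixes S :: "'a::banach \<Rightarrow> 'a"
  assumes add: "\<And>x y. S (x + y) = S x + S y" and near: "\<And>x. norm (S x - x) \<le> norm x / 2"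
  shows "bij S"
proof -
  have diff: "S x - S y = S (x - y)" for x y
    using add[of "x - y" y] by simp
  have "\<exists>!x. S x = y" for y
  proof -
    have "\<exists>!x. y - (S x - x) = x"
    proof (rule banach_fix_type[where c = "1 / 2"]; (intro allI)?)
      fix x x'
      have "y - (S x - x) - (y - (S x' - x')) = - (S (x - x') - (x - x'))"
        by (simp add: diff[symmetric])
      then show "dist (y - (S x - x)) (y - (S x' - x')) \<le> 1 / 2 * dist x x'"
        using near[of "x - x'"] by (simp only: dist_norm norm_minus_cancel)
    qed simp_all
    moreover have "y - (S x - x) = x \<longleftrightarrow> S x = y" for x by (auto simp: algebra_simps)
    ultimately show ?thesis by simp
  qed
  then show ?thesis by (metis bijI')
qed

section \<open>Actions of finite groups\<close>

text \<open>A bijection with an initial segment of the naturals admits families indexed by group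
  elements.\<close>

lemma quasi_basis_finite_index:
  assumes "finite I" and left: "\<And>a. a = (\<Sum>i\<in>I. u i * E (v i * a))"
    and right: "\<And>a. a = (\<Sum>i\<in>I. E (a * u i) * v i)"
  shows "finite_index E"
proof -
  obtain b where b: "bij_betw b {..<card I} I"
    using ex_bij_betw_nat_finite[OF assms(1)] by (auto simp: atLeast0LessThan)
  have "quasi_basis E (card I) (u \<circ> b) (v \<circ> b)"
    unfolding quasi_basis_def
    using left right sum.reindex_bij_betw[OF b, of "\<lambda>i. u i * E (v i * _)"]
      sum.reindex_bij_betw[OF b, of "\<lambda>i. E (_ * u i) * v i"] by simp
  then show ?thesis by (auto simp: finite_index_def)
qed

text \<open>Since \<open>v i = (\<Sum>j\<in>J. E (v i * s j) * t j)\<close>, the left expansion through \<open>(u, v)\<close> is a left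
  expansion through \<open>(s, t)\<close>.\<close>

lemma finite_index_if_left_right:
  fixes E :: "'a::unital_cstar_algebra \<Rightarrow> 'a"
  assumes "finite I" "finite J" and add: "\<And>x y. E (x + y) = E x + E y"
    and E: "\<And>x y. E (E x * y) = E x * E y"
    and left: "\<And>a. a = (\<Sum>i\<in>I. u i * E (v i * a))"
    and right: "\<And>a. a = (\<Sum>j\<in>J. E (a * s j) * t j)"
  shows "finite_index E"
proof (rule quasi_basis_finite_index[OF assms(2) _ right])
  fix a
  have E0: "E 0 = 0" using add[of 0 0] by simp
  have Esum: "E (\<Sum>j\<in>J. f j) = (\<Sum>j\<in>J. E (f j))" for f
    using sum_comp_morphism[of E f J] E0 add by (simp add: comp_def)
  have "a = (\<Sum>i\<in>I. u i * E (v i * a))" by (rule left)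
  also have "\<dots> = (\<Sum>i\<in>I. u i * E ((\<Sum>j\<in>J. E (v i * s j) * t j) * a))"
    by (simp only: right[symmetric])
  also have "\<dots> = (\<Sum>i\<in>I. \<Sum>j\<in>J. u i * E (v i * s j) * E (t j * a))"
    by (simp add: sum_distrib_right sum_distrib_left mult.assoc Esum E)
  also have "\<dots> = (\<Sum>j\<in>J. (\<Sum>i\<in>I. u i * E (v i * s j)) * E (t j * a))"
    by (subst sum.swap) (simp add: sum_distrib_right)
  also have "\<dots> = (\<Sum>j\<in>J. s j * E (t j * a))"
    by (simp only: left[symmetric])
  finally show "a = (\<Sum>j\<in>J. s j * E (t j * a))" .
qed

section \<open>The action and its canonical expectation\<close>

locale finite_group_action = group G for G :: "('g, 'b) monoid_scheme" (structure) +
  fixes \<alpha> :: "'g \<Rightarrow> 'a::unital_cstar_algebra \<Rightarrow> 'a"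
  assumes finite_carrier: "finite (carrier G)" and hom: "\<alpha> \<in> hom G star_Aut"
begin

abbreviation "P \<equiv> fixed_point_algebra G \<alpha>"
abbreviation "E \<equiv> canonical_expectation G \<alpha>"
abbreviation "N \<equiv> order G"
abbreviation "\<beta> g \<equiv> induced_map (\<alpha> g)"

lemma N_pos: "0 < N"
  using finite_carrier order_gt_0_iff_finite by simp

lemma aut: "g \<in> carrier G \<Longrightarrow> star_automorphism (\<alpha> g)"
  using hom by (auto simp: hom_def star_Aut_def)

lemma act_mult: "g \<in> carrier G \<Longrightarrow> h \<in> carrier G \<Longrightarrow> \<alpha> (g \<otimes> h) = \<alpha> g \<circ> \<alpha> h"
  using hom by (auto simp: hom_def star_Aut_def)

text \<open>\<open>hom\<close> asks for multiplicativity only; \<open>\<alpha> \<one>\<close> is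
  idempotent and injective, hence the identity.\<close>

lemma act_one: "\<alpha> \<one> = id"
proof
  fix x
  have "\<alpha> \<one> (\<alpha> \<one> x) = \<alpha> \<one> x"
    using act_mult[of \<one> \<one>] by (simp add: fun_eq_iff)
  then show "\<alpha> \<one> x = id x"
    using aut[of \<one>] by (simp add: star_automorphism_def bij_def inj_eq)
qed

lemmas act_simps = star_automorphism_add[OF aut] star_automorphism_mult[OF aut]
  star_automorphism_star[OF aut] star_automorphism_scaleR[OF aut] star_automorphism_scaleC[OF aut]
  star_automorphism_zero[OF aut] star_automorphism_one[OF aut] star_automorphism_diff[OF aut]

lemma act_of_nat: "g \<in> carrier G \<Longrightarrow> \<alpha> g (of_nat k) = of_nat k"
  by (induction k) (simp_all add: act_simps)

lemma act_sum: "g \<in> carrier G \<Longrightarrow> \<alpha> g (\<Sum>i\<in>I. f i) = (\<Sum>i\<in>I. \<alpha> g (f i))"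
  by (induction I rule: infinite_finite_induct) (simp_all add: act_simps)

lemma sum_translate_left: "g \<in> carrier G \<Longrightarrow> (\<Sum>h\<in>carrier G. f (g \<otimes> h)) = (\<Sum>h\<in>carrier G. f h)"
  by (rule sum.reindex_bij_witness[where i = "\<lambda>h. inv g \<otimes> h" and j = "\<lambda>h. g \<otimes> h"])
    (simp_all add: m_assoc[symmetric])

lemma act_expectation: "g \<in> carrier G \<Longrightarrow> \<alpha> g (E x) = E x"
  using sum_translate_left[of g "\<lambda>h. \<alpha> h x"]
  by (simp add: canonical_expectation_def act_simps act_sum act_mult)

text \<open>The factor \<open>of_nat N\<close> replaces division by \<open>N\<close>, since it also
  makes sense in the sequence algebra, which carries no real scalar multiplication here.\<close>

lemma of_nat_expectation: "of_nat N * E x = (\<Sum>g\<in>carrier G. \<alpha> g x)"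
proof -
  have "of_nat N * y = real N *\<^sub>R y" for y :: 'a by (simp add: scaleR_conv_of_real)
  then show ?thesis using N_pos by (simp add: canonical_expectation_def)
qed

lemma expectation_fixed_mult:
  assumes "\<And>g. g \<in> carrier G \<Longrightarrow> \<alpha> g p = p"
  shows "E (p * x) = p * E x" "E (x * p) = E x * p"
  using assms by (simp_all add: canonical_expectation_def act_simps sum_distrib_left sum_distrib_right)

lemma expectation_add: "E (x + y) = E x + E y"
  by (simp add: canonical_expectation_def act_simps sum.distrib scaleR_add_right)

lemma expectation_scaleC: "E (c *\<^sub>C x) = c *\<^sub>C E x"
proof -
  have "c *\<^sub>C y = (c *\<^sub>C 1) * y" for y :: 'a by (simp add: mult_scaleC_left)
  then show ?thesis
    by (metis expectation_fixed_mult(1) act_simps(5) act_simps(7))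
qed

lemma expectation_star: "E (star x) = star (E x)"
  by (simp add: canonical_expectation_def act_simps star_scaleR star_sum)

lemma norm_expectation: "norm (E x) \<le> norm x"
proof -
  have "norm (\<Sum>g\<in>carrier G. \<alpha> g x) \<le> (\<Sum>g\<in>carrier G. norm x)"
    by (rule sum_norm_le) (rule norm_star_automorphism_le[OF aut])
  then show ?thesis
    using N_pos by (simp add: canonical_expectation_def order_def divide_le_eq mult.commute)
qed

lemma conditional_expectation: "conditional_expectation P E"
proof -
  have "P = (\<Inter>g\<in>carrier G. {x. \<alpha> g x = x})" by (auto simp: fixed_point_algebra_def)
  moreover have "closed {x. \<alpha> g x = x}" if "g \<in> carrier G" for g
    by (rule closed_Collect_eq[OF bounded_linear.continuous_on[OF
          star_automorphism_bounded_linear[OF aut[OF that]] continuous_on_id] continuous_on_id])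
  ultimately have "closed P" by (simp add: closed_INT)
  then have "unital_cstar_subalgebra P"
    by (auto simp: unital_cstar_subalgebra_def fixed_point_algebra_def act_simps)
  moreover have "E p = p" if "p \<in> P" for p
    using that N_pos
    by (simp add: fixed_point_algebra_def canonical_expectation_def order_def
        sum_constant_scaleR del: sum_constant)
  ultimately show ?thesis
    by (auto simp: conditional_expectation_def complex_linear_def expectation_add
        expectation_scaleC act_expectation norm_expectation expectation_fixed_mult
        fixed_point_algebra_def)
qed

lemma complex_linear_expectation: "complex_linear E"
  by (simp add: complex_linear_def expectation_add expectation_scaleC)

lemma of_nat_induced_expectation: "of_nat N * induced_map E x = (\<Sum>g\<in>carrier G. \<beta> g x)"
proof -
  define f where "f = rep_seqalg x"
  have x: "x = abs_seqalg f" and B: "Bseq f" by (simp_all add: f_def abs_rep_seqalg Bseq_rep_seqalg)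
  have "bounded_linear E"
    by (rule bounded_linear_intro[where K = 1])
      (simp_all add: expectation_add expectation_scaleC scaleR_eq_scaleC norm_expectation)
  then have "of_nat N * induced_map E x = abs_seqalg (\<lambda>n. of_nat N * E (f n))"
    unfolding const_seq_of_nat[symmetric]
    by (simp add: x induced_map_abs B abs_seqalg_const[symmetric] abs_seqalg_times
        Bseq_bounded_linear)
  also have "\<dots> = (\<Sum>g\<in>carrier G. abs_seqalg (\<lambda>n. \<alpha> g (f n)))"
    by (simp add: of_nat_expectation abs_seqalg_sum B Bseq_bounded_linear
        star_automorphism_bounded_linear aut)
  also have "\<dots> = (\<Sum>g\<in>carrier G. \<beta> g x)"
    by (simp add: x induced_map_abs B star_automorphism_bounded_linear aut)
  finally show ?thesis .
qed

lemma induced_act_mult: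
  "g \<in> carrier G \<Longrightarrow> h \<in> carrier G \<Longrightarrow> \<beta> g (\<beta> h x) = \<beta> (g \<otimes> h) x"
  by (simp add: induced_map_comp aut act_mult)

lemma induced_act_one: "\<beta> \<one> x = x"
  by (simp add: induced_map_def act_one abs_rep_seqalg)

section \<open>Group coefficients of a quasi-basis\<close>

text \<open>In the crossed product, where unitaries implement the action, place the sum of these
  unitaries between \<open>u i\<close> and \<open>v i\<close> and add over \<open>i\<close>: this is
  the coefficient of the unitary for \<open>g\<close>.\<close>

definition coef :: "nat \<Rightarrow> (nat \<Rightarrow> 'a) \<Rightarrow> (nat \<Rightarrow> 'a) \<Rightarrow> 'g \<Rightarrow> 'a" where
  "coef n u v g = (\<Sum>i<n. u i * \<alpha> g (v i))"

lemma Index_eq_coef: "quasi_basis E n u v \<Longrightarrow> Index E = coef n u v \<one>"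
  by (simp add: Index_eq[OF complex_linear_expectation] coef_def act_one)

lemma quasi_basis_left: "quasi_basis E n u v \<Longrightarrow> (\<Sum>i<n. u i * E (v i * a)) = a"
  and quasi_basis_right: "quasi_basis E n u v \<Longrightarrow> (\<Sum>i<n. E (a * u i) * v i) = a"
  by (simp_all add: quasi_basis_def)

text \<open>Summing over the group first produces \<open>N\<close> times an expectation, and the
  left expansion of \<open>a\<close> remains.\<close>

lemma sum_coef_act:
  assumes "quasi_basis E n u v"
  shows "(\<Sum>g\<in>carrier G. coef n u v g * \<alpha> g a) = of_nat N * a"
proof -
  have "(\<Sum>g\<in>carrier G. coef n u v g * \<alpha> g a) = (\<Sum>i<n. \<Sum>g\<in>carrier G. u i * \<alpha> g (v i * a))"
    by (subst sum.swap) (simp add: coef_def sum_distrib_right act_simps mult.assoc)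
  also have "\<dots> = (\<Sum>i<n. of_nat N * (u i * E (v i * a)))"
  proof (intro sum.cong refl)
    fix i
    have "(\<Sum>g\<in>carrier G. u i * \<alpha> g (v i * a)) = (u i * of_nat N) * E (v i * a)"
      by (simp add: sum_distrib_left[symmetric] of_nat_expectation[symmetric] mult.assoc)
    also have "u i * of_nat N = of_nat N * u i" by (simp add: mult_of_nat_commute)
    finally show "(\<Sum>g\<in>carrier G. u i * \<alpha> g (v i * a)) = of_nat N * (u i * E (v i * a))"
      by (simp only: mult.assoc)
  qed
  also have "\<dots> = of_nat N * a"
    by (simp add: sum_distrib_left[symmetric] quasi_basis_left[OF assms])
  finally show ?thesis .
qed

text \<open>The left expansion of \<open>a * u i\<close> has coefficients fixed by
  \<open>\<alpha> g\<close>. They move inside \<open>\<alpha> g\<close>, where the right expansion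
  of \<open>v j * a\<close> absorbs them.\<close>

lemma coef_intertwines:
  assumes qb: "quasi_basis E n u v" and g: "g \<in> carrier G"
  shows "a * coef n u v g = coef n u v g * \<alpha> g a"
proof -
  have "a * coef n u v g = (\<Sum>i<n. (a * u i) * \<alpha> g (v i))"
    by (simp add: coef_def sum_distrib_left mult.assoc)
  also have "\<dots> = (\<Sum>i<n. (\<Sum>j<n. u j * E (v j * (a * u i))) * \<alpha> g (v i))"
    by (simp only: quasi_basis_left[OF qb])
  also have "\<dots> = (\<Sum>j<n. u j * \<alpha> g (\<Sum>i<n. E ((v j * a) * u i) * v i))"
    by (simp add: act_sum g act_simps act_expectation sum_distrib_left sum_distrib_right mult.assoc)
      (rule sum.swap)
  also have "\<dots> = coef n u v g * \<alpha> g a"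
    unfolding quasi_basis_right[OF qb]
    by (simp add: coef_def act_simps g sum_distrib_right mult.assoc)
  finally show ?thesis .
qed

text \<open>\<open>E\<close> preserves adjoints, so taking adjoints interchanges the two expansions.
  As the index does not depend on the quasi-basis, it is self-adjoint.\<close>

lemma quasi_basis_star:
  assumes "quasi_basis E n u v"
  shows "quasi_basis E n (\<lambda>i. star (v i)) (\<lambda>i. star (u i))"
proof -
  have "(\<Sum>i<n. star (v i) * E (star (u i) * a)) = star (\<Sum>i<n. E (star a * u i) * v i)"
    and "(\<Sum>i<n. E (a * star (v i)) * star (u i)) = star (\<Sum>i<n. u i * E (v i * star a))" for a
    by (simp_all add: star_sum star_mult expectation_star[symmetric] star_star)
  then show ?thesis
    by (simp add: quasi_basis_def quasi_basis_left[OF assms] quasi_basis_right[OF assms] star_star)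
qed

lemma star_Index: "quasi_basis E n u v \<Longrightarrow> star (Index E) = Index E"
  using Index_eq[OF complex_linear_expectation, of n u v]
    Index_eq[OF complex_linear_expectation quasi_basis_star, of n u v]
  by (simp add: star_sum star_mult)

text \<open>Expanding only the starred factor leaves \<open>sum_coef_act\<close> at
  \<open>a = star (v i)\<close>.\<close>

lemma sum_coef_star:
  assumes "quasi_basis E n u v"
  shows "(\<Sum>g\<in>carrier G. coef n u v g * star (coef n u v g)) = of_nat N * Index E"
proof -
  have "(\<Sum>g\<in>carrier G. coef n u v g * star (coef n u v g)) =
      (\<Sum>g\<in>carrier G. \<Sum>i<n. coef n u v g * \<alpha> g (star (v i)) * star (u i))"
    by (intro sum.cong refl)
      (simp add: coef_def[of n u v "_"] star_sum star_mult act_simps sum_distrib_left mult.assoc)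
  also have "\<dots> = (\<Sum>i<n. (\<Sum>g\<in>carrier G. coef n u v g * \<alpha> g (star (v i))) * star (u i))"
    by (subst sum.swap) (simp add: sum_distrib_right)
  also have "\<dots> = of_nat N * star (\<Sum>i<n. u i * v i)"
    by (simp add: sum_coef_act[OF assms] star_sum star_mult sum_distrib_left mult.assoc)
  also have "\<dots> = of_nat N * Index E"
    using star_Index[OF assms] Index_eq[OF complex_linear_expectation assms] by simp
  finally show ?thesis .
qed

text \<open>The identity in the algebra holds at every term of a representative of
  \<open>x\<close>.\<close>

lemma sum_coef_induced:
  assumes "quasi_basis E n u v"
  shows "(\<Sum>g\<in>carrier G. const_seq (coef n u v g) * \<beta> g x) = of_nat N * x"
proof -
  define f where "f = rep_seqalg x"
  have x: "x = abs_seqalg f" and B: "Bseq f" by (simp_all add: f_def abs_rep_seqalg Bseq_rep_seqalg)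
  have "(\<Sum>g\<in>carrier G. const_seq (coef n u v g) * \<beta> g x) =
      (\<Sum>g\<in>carrier G. abs_seqalg (\<lambda>k. coef n u v g * \<alpha> g (f k)))"
    by (simp add: x induced_map_abs B star_automorphism_bounded_linear aut Bseq_bounded_linear
        abs_seqalg_const[symmetric] abs_seqalg_times)
  also have "\<dots> = abs_seqalg (\<lambda>k. of_nat N * f k)"
    by (subst abs_seqalg_sum) (simp_all add: Bseq_mult_alg Bseq_bounded_linear B
        star_automorphism_bounded_linear aut sum_coef_act[OF assms])
  also have "\<dots> = of_nat N * x"
    unfolding const_seq_of_nat[symmetric]
    by (simp add: x B abs_seqalg_const[symmetric] abs_seqalg_times)
  finally show ?thesis .
qed

lemma coef_intertwines_induced:
  assumes "quasi_basis E n u v" and g: "g \<in> carrier G"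
  shows "x * const_seq (coef n u v g) = const_seq (coef n u v g) * \<beta> g x"
proof -
  define f where "f = rep_seqalg x"
  have x: "x = abs_seqalg f" and B: "Bseq f" by (simp_all add: f_def abs_rep_seqalg Bseq_rep_seqalg)
  show ?thesis
    by (simp add: x induced_map_abs B star_automorphism_bounded_linear aut[OF g] Bseq_bounded_linear
        abs_seqalg_const[symmetric] abs_seqalg_times coef_intertwines[OF assms])
qed

section \<open>From the expectation to the action\<close>

lemma rohlin_action_if_rohlin_expectation:
  assumes simple: "simple_cstar_algebra TYPE('a)" and inj: "inj_on \<alpha> (carrier G)"
    and E: "rohlin_expectation P E"
  shows "rohlin_action G \<alpha>"
proof -
  let ?C = "const_seq :: 'a \<Rightarrow> 'a seqalg"
  from E obtain e j n u v where e: "e \<in> central_sequences" "projection e"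
    and j: "j * Index E = 1" "induced_map E e = ?C j"
    and inj_e: "inj (\<lambda>x. ?C x * e)" and qb: "quasi_basis E n u v"
    unfolding rohlin_expectation_def finite_index_def by blast
  define z where "z = Index E"
  define c where "c = coef n u v"
  define f where "f g = \<beta> g e" for g
  have z: "z = c \<one>" by (simp add: z_def c_def Index_eq_coef[OF qb])
  have zc: "a * z = z * a" for a
    using coef_intertwines[OF qb one_closed] by (simp add: z c_def act_one)
  have sz: "star z = z" by (simp add: z_def star_Index[OF qb])
  have jz: "z * j = 1" "j * z = 1" using j(1) zc[of j] by (simp_all add: z_def)
  have f_one: "f \<one> = e" by (simp add: f_def induced_act_one)
  have f_central: "f g \<in> central_sequences" and f_proj: "projection (f g)" if "g \<in> carrier G" for g
    using that e by (simp_all add: f_def induced_map_central induced_map_projection aut)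
  have se: "star e = e" and ee: "e * e = e" using e(2) by (simp_all add: projection_def)
  have sf: "star (f g) = f g" and ff: "f g * f g = f g" if "g \<in> carrier G" for g
    using f_proj[OF that] by (simp_all add: projection_def)
  have eC: "e * ?C a = ?C a * e" for a using e(1) by (rule central_sequences_commute)
  have fC: "f g * ?C a = ?C a * f g" if "g \<in> carrier G" for g a
    using f_central[OF that] by (rule central_sequences_commute)
  have sum_f: "(\<Sum>g\<in>carrier G. f g) = of_nat N * ?C j"
    unfolding f_def of_nat_induced_expectation[symmetric] j(2) ..
  have sum_cf: "(\<Sum>g\<in>carrier G. ?C (c g) * f g) = of_nat N * e"
    unfolding f_def c_def by (rule sum_coef_induced[OF qb])
  \<comment> \<open>Both \<open>?C (c g) * e\<close> and \<open>?C (c g) * f g\<close> equal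
    \<open>e * ?C (c g)\<close>, by centrality and by intertwining respectively.\<close>
  have c_swap: "?C (c g) * (f g - e) = 0" if "g \<in> carrier G" for g
    using coef_intertwines_induced[OF qb that, of e] eC
    by (simp add: c_def f_def right_diff_distrib)

  define y where "y g = ?C (c g) * e - ?C z * (e * f g)" for g
  \<comment> \<open>In every term \<open>g\<close> enters only through
    \<open>c g * star (c g)\<close>, \<open>?C (c g) * f g\<close> or \<open>f g\<close>, whose sums
    over the group are known.\<close>
  have y_star: "y g * star (y g) = e * ?C (c g * star (c g)) * e - e * (?C (c g) * f g) * (e * ?C z)
      - ?C z * e * star (?C (c g) * f g) * e + ?C z * e * f g * e * ?C z"
    if g: "g \<in> carrier G" for g
  proof -
    have "star (y g) = e * ?C (star (c g)) - f g * e * ?C z"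
      by (simp add: y_def star_diff star_mult const_seq_star[symmetric] se sf[OF g] sz)
    then have "y g * star (y g) =
        ?C (c g) * (e * e) * ?C (star (c g)) - ?C (c g) * e * f g * (e * ?C z)
        - ?C z * e * f g * (e * ?C (star (c g))) + ?C z * e * (f g * f g) * e * ?C z"
      by (simp add: y_def left_diff_distrib right_diff_distrib mult.assoc)
    also have "?C (c g) * (e * e) * ?C (star (c g)) = ?C (c g) * e * (e * ?C (star (c g)))"
      by (simp only: mult.assoc)
    also have "?C (c g) * e * (e * ?C (star (c g))) = e * ?C (c g) * (?C (star (c g)) * e)"
      by (simp only: eC)
    also have "\<dots> = e * ?C (c g * star (c g)) * e"
      by (simp only: const_seq_mult mult.assoc)
    also have "?C (c g) * e * f g * (e * ?C z) = e * (?C (c g) * f g) * (e * ?C z)"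
      unfolding eC[of "c g", symmetric] by (simp only: mult.assoc)
    also have "?C z * e * f g * (e * ?C (star (c g))) = ?C z * e * star (?C (c g) * f g) * e"
    proof -
      have "star (?C (c g) * f g) = f g * ?C (star (c g))"
        by (simp add: star_mult sf[OF g] const_seq_star)
      then show ?thesis by (simp only: eC mult.assoc)
    qed
    finally show ?thesis by (simp only: ff[OF g])
  qed
  have "(\<Sum>g\<in>carrier G. y g * star (y g)) =
      e * ?C (\<Sum>g\<in>carrier G. c g * star (c g)) * e - e * (\<Sum>g\<in>carrier G. ?C (c g) * f g) * (e * ?C z)
      - ?C z * e * star (\<Sum>g\<in>carrier G. ?C (c g) * f g) * e
      + ?C z * e * (\<Sum>g\<in>carrier G. f g) * e * ?C z"
    by (simp add: y_star sum.distrib sum_subtractf const_seq_sum star_sum sum_distrib_left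
        sum_distrib_right)
  also have "\<dots> = 0"
  proof -
    have N_left: "x * of_nat N = of_nat N * x" "x * (of_nat N * x') = of_nat N * (x * x')"
      for x x' :: "'a seqalg"
      using mult_of_nat_commute[of N x, symmetric]
      by (simp_all only: mult.assoc[symmetric])
    have C_left: "e * (?C a * x) = ?C a * (e * x)" for a x
      using eC[of a] by (simp only: mult.assoc[symmetric])
    have "?C z * (?C j * x) = x" for x
      by (simp add: mult.assoc[symmetric] const_seq_mult[symmetric] jz)
    moreover have "e * (e * x) = e * x" for x by (simp add: mult.assoc[symmetric] ee)
    moreover have "(\<Sum>g\<in>carrier G. c g * star (c g)) = of_nat N * z"
      by (simp add: c_def z_def sum_coef_star[OF qb])
    moreover have "star (of_nat N * e) = of_nat N * e"
      using star_sum[of "\<lambda>_. 1 :: 'a seqalg" "{..<N}"] by (simp add: star_mult se mult_of_nat_commute)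
    ultimately show ?thesis
      by (simp add: sum_cf sum_f const_seq_mult mult.assoc N_left C_left eC ee)
  qed
  finally have y0: "y g = 0" if "g \<in> carrier G" for g
    using seqalg_eq_0_if_sum_mult_star_eq_0[OF finite_carrier that, of y] by simp

  have c0: "c g = 0" if g: "g \<in> carrier G" "g \<noteq> \<one>" for g
  proof (rule ccontr)
    assume "c g \<noteq> 0"
    have "f g - e \<in> central_sequences"
      by (simp add: central_sequences_def left_diff_distrib right_diff_distrib eC fC[OF g(1)])
    then have "f g = e"
      using const_seq_mult_central_eq_0[OF simple _ c_swap[OF g(1)]] \<open>c g \<noteq> 0\<close> by simp
    then have "?C (c g) * e = ?C z * e" using y0[OF g(1)] by (simp add: y_def ee)
    then have cz: "c g = z" using injD[OF inj_e, of "c g" z] by simp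
    \<comment> \<open>As \<open>c g = z\<close> is central and invertible, the intertwining relation
      leaves no room for a nontrivial \<open>\<alpha> g\<close>.\<close>
    have "\<alpha> g a = a" for a
    proof -
      have "z * a = z * \<alpha> g a"
        using coef_intertwines[OF qb g(1), of a] cz zc[of a] by (simp add: c_def)
      then have "j * z * a = j * z * \<alpha> g a" by (simp only: mult.assoc)
      then show ?thesis by (simp add: jz)
    qed
    then have "\<alpha> g = \<alpha> \<one>" by (simp add: fun_eq_iff act_one)
    then show False using inj g by (auto dest: inj_onD)
  qed
  have ef: "e * f g = 0" if g: "g \<in> carrier G" "g \<noteq> \<one>" for g
  proof -
    have "?C z * (e * f g) = 0" using y0[OF g(1)] c0[OF g] by (simp add: y_def)
    then have "?C j * ?C z * (e * f g) = 0" by (simp only: mult.assoc mult_zero_right)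
    then show ?thesis by (simp add: const_seq_mult[symmetric] jz)
  qed
  \<comment> \<open>At \<open>1\<close> the operator identity reduces to the coefficient at
    \<open>\<one>\<close>, so \<open>z = of_nat N\<close> and the sum of the \<open>f g\<close>,
    already known to be \<open>of_nat N * ?C j\<close>, is \<open>1\<close>.\<close>
  have "of_nat N = (\<Sum>g\<in>carrier G. c g * \<alpha> g 1)"
    using sum_coef_act[OF qb, of 1] by (simp add: c_def)
  also have "\<dots> = (\<Sum>g\<in>{\<one>}. c g * \<alpha> g 1)"
    using c0 finite_carrier by (intro sum.mono_neutral_right) auto
  also have "\<dots> = z" by (simp add: z act_one)
  finally have "?C (of_nat N * j) = 1" using jz by simp
  then have sum1: "(\<Sum>g\<in>carrier G. f g) = 1" by (simp add: sum_f const_seq_mult)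
  have orth: "f g * f h = 0" if gh: "g \<in> carrier G" "h \<in> carrier G" "g \<noteq> h" for g h
  proof -
    \<comment> \<open>Translation by \<open>inv g\<close> reduces orthogonality to \<open>e\<close>
      and a single translate.\<close>
    have "f h = \<beta> g (f (inv g \<otimes> h))"
      using gh by (simp add: f_def induced_act_mult m_assoc[symmetric])
    then have "f g * f h = \<beta> g (e * f (inv g \<otimes> h))"
      using gh by (simp add: f_def induced_map_mult aut)
    moreover have "inv g \<otimes> h \<noteq> \<one>" using gh by (metis inv_equality inv_inv inv_closed)
    ultimately show ?thesis using gh by (simp add: ef induced_map_zero aut)
  qed
  show ?thesis
    unfolding rohlin_action_def
  proof (intro exI[of _ f] conjI ballI impI)
    show "\<beta> g (f h) = f (g \<otimes> h)" if "g \<in> carrier G" "h \<in> carrier G" for g h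
      using that by (simp add: f_def induced_act_mult)
  qed (use f_central f_proj orth sum1 in auto)
qed

section \<open>From the action to the expectation\<close>

text \<open>The pairs \<open>(w h, N w h)\<close> below form an approximate quasi-basis when \<open>w h\<close> is a late enough
  term of a sequence representing the Rohlin projection \<open>e h\<close>.\<close>

lemma rohlin_action_approx:
  assumes e: "\<And>g. g \<in> carrier G \<Longrightarrow> projection (e g)"
    and orth: "\<And>g h. g \<in> carrier G \<Longrightarrow> h \<in> carrier G \<Longrightarrow> g \<noteq> h \<Longrightarrow> e g * e h = 0"
    and sum1: "(\<Sum>g\<in>carrier G. e g) = 1"
    and shift: "\<And>g h. g \<in> carrier G \<Longrightarrow> h \<in> carrier G \<Longrightarrow> \<beta> g (e h) = e (g \<otimes> h)"
    and \<epsilon>: "0 < \<epsilon>"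
  obtains w :: "'g \<Rightarrow> 'a" where
    "\<And>g. g \<in> carrier G \<Longrightarrow> norm ((\<Sum>h\<in>carrier G. w h * \<alpha> g (w h)) - of_bool (g = \<one>)) < \<epsilon>"
    "\<And>g. g \<in> carrier G \<Longrightarrow> norm ((\<Sum>h\<in>carrier G. \<alpha> g (w h) * w h) - of_bool (g = \<one>)) < \<epsilon>"
proof -
  define f where "f h = rep_seqalg (e h)" for h
  have abs: "e h = abs_seqalg (f h)" and B: "Bseq (f h)" for h
    by (simp_all add: f_def abs_rep_seqalg Bseq_rep_seqalg)
  define l r where "l g k = (\<Sum>h\<in>carrier G. f h k * \<alpha> g (f h k)) - of_bool (g = \<one>)"
    and "r g k = (\<Sum>h\<in>carrier G. \<alpha> g (f h k) * f h k) - of_bool (g = \<one>)" for g k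
  have "l g \<longlonglongrightarrow> 0 \<and> r g \<longlonglongrightarrow> 0" if g: "g \<in> carrier G" for g
  proof -
    note bl = star_automorphism_bounded_linear[OF aut[OF g]]
    have Bl: "Bseq (\<lambda>k. \<Sum>h\<in>carrier G. f h k * \<alpha> g (f h k))"
      and Br: "Bseq (\<lambda>k. \<Sum>h\<in>carrier G. \<alpha> g (f h k) * f h k)"
      by (simp_all add: Bseq_sum Bseq_mult_alg Bseq_bounded_linear[OF bl] B)
    \<comment> \<open>Translation by \<open>g \<noteq> \<one>\<close> has no fixed point in the
      group, so \<open>e h\<close> is orthogonal to its translate; summing over \<open>h\<close>
      gives a Kronecker delta.\<close>
    have "e h * e (g \<otimes> h) = of_bool (g = \<one>) * e h \<and> e (g \<otimes> h) * e h = of_bool (g = \<one>) * e h"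
      if h: "h \<in> carrier G" for h
    proof (cases "g = \<one>")
      case True
      then show ?thesis using e[OF h] h by (simp add: projection_def)
    next
      case False
      then have "g \<otimes> h \<noteq> h" using g h by simp
      then show ?thesis
        using False orth[of h "g \<otimes> h"] orth[of "g \<otimes> h" h] g h by auto
    qed
    then have prods: "e h * e (g \<otimes> h) = of_bool (g = \<one>) * e h"
      "e (g \<otimes> h) * e h = of_bool (g = \<one>) * e h" if "h \<in> carrier G" for h
      using that by blast+
    have "abs_seqalg (l g) = (\<Sum>h\<in>carrier G. e h * \<beta> g (e h)) - const_seq (of_bool (g = \<one>))"
      unfolding l_def abs_seqalg_const[symmetric] using Bl
      by (simp add: abs induced_map_abs[OF bl] B Bseq_bounded_linear[OF bl] Bseq_mult_alg
          abs_seqalg_times abs_seqalg_sum abs_seqalg_minus)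
    also have "\<dots> = 0"
      using g by (simp add: shift prods sum_distrib_left[symmetric] sum1)
    finally have l0: "abs_seqalg (l g) = 0" .
    have "abs_seqalg (r g) = (\<Sum>h\<in>carrier G. \<beta> g (e h) * e h) - const_seq (of_bool (g = \<one>))"
      unfolding r_def abs_seqalg_const[symmetric] using Br
      by (simp add: abs induced_map_abs[OF bl] B Bseq_bounded_linear[OF bl] Bseq_mult_alg
          abs_seqalg_times abs_seqalg_sum abs_seqalg_minus)
    also have "\<dots> = 0"
      using g by (simp add: shift prods sum_distrib_left[symmetric] sum1)
    finally have r0: "abs_seqalg (r g) = 0" .
    have "Bseq (l g)" "Bseq (r g)"
      using Bseq_add_alg[OF Bl, of "\<lambda>_. - of_bool (g = \<one>)"]
        Bseq_add_alg[OF Br, of "\<lambda>_. - of_bool (g = \<one>)"]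
      by (simp_all add: l_def[abs_def] r_def[abs_def])
    then show ?thesis using l0 r0 by (simp add: abs_seqalg_eq_0_iff)
  qed
  then have "eventually (\<lambda>k. norm (l g k) < \<epsilon> \<and> norm (r g k) < \<epsilon>) sequentially"
    if "g \<in> carrier G" for g
    using that \<epsilon> by (auto simp: tendsto_iff eventually_conj_iff)
  then have "eventually (\<lambda>k. \<forall>g\<in>carrier G. norm (l g k) < \<epsilon> \<and> norm (r g k) < \<epsilon>) sequentially"
    using finite_carrier by (simp add: eventually_ball_finite_distrib)
  then obtain k where "\<forall>g\<in>carrier G. norm (l g k) < \<epsilon> \<and> norm (r g k) < \<epsilon>"
    by (auto simp: eventually_sequentially)
  then show thesis by (intro that[of "\<lambda>h. f h k"]) (auto simp: l_def r_def)
qed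

text \<open>The \<open>N\<close> errors add up to the constant \<open>1 / 2\<close> demanded by
  \<open>bij_if_near_identity\<close>.\<close>

lemma norm_sum_act_minus_le:
  fixes F :: "'g \<Rightarrow> 'a"
  assumes "\<And>g. g \<in> carrier G \<Longrightarrow> norm (F g - of_bool (g = \<one>) * a) \<le> norm a / (2 * real N)"
  shows "norm ((\<Sum>g\<in>carrier G. F g) - a) \<le> norm a / 2"
proof -
  have "(\<Sum>g\<in>carrier G. of_bool (g = \<one>) * a) = (\<Sum>g\<in>{\<one>}. of_bool (g = \<one>) * a)"
    using finite_carrier by (intro sum.mono_neutral_right) auto
  then have "(\<Sum>g\<in>carrier G. F g) - a = (\<Sum>g\<in>carrier G. F g - of_bool (g = \<one>) * a)"
    by (simp add: sum_subtractf)
  also have "norm \<dots> \<le> (\<Sum>g\<in>carrier G. norm a / (2 * real N))"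
    by (rule sum_norm_le) (rule assms)
  also have "\<dots> = norm a / 2" using N_pos by (simp add: order_def)
  finally show ?thesis .
qed

text \<open>The approximate left and right expansions define additive maps \<open>S\<close> and
  \<open>T\<close> close to the identity, hence bijective. Replacing \<open>w h\<close> by its
  preimage under \<open>S\<close>, and \<open>v h\<close> by its preimage under \<open>T\<close>,
  makes the expansions exact.\<close>

lemma finite_index_if_approx:
  assumes left: "\<And>g. g \<in> carrier G \<Longrightarrow>
      norm ((\<Sum>h\<in>carrier G. w h * \<alpha> g (w h)) - of_bool (g = \<one>)) < 1 / (2 * real N)"
    and right: "\<And>g. g \<in> carrier G \<Longrightarrow>
      norm ((\<Sum>h\<in>carrier G. \<alpha> g (w h) * w h) - of_bool (g = \<one>)) < 1 / (2 * real N)"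
  shows "finite_index E"
proof -
  \<comment> \<open>The factor \<open>N\<close> cancels the averaging constant in
    \<open>E\<close>.\<close>
  define v where "v h = of_nat N * w h" for h
  define S T where "S a = (\<Sum>h\<in>carrier G. w h * E (v h * a))"
    and "T a = (\<Sum>h\<in>carrier G. E (a * w h) * v h)" for a
  have NE: "E (of_nat N * x) = of_nat N * E x" for x
    by (rule expectation_fixed_mult) (simp add: act_of_nat)
  have vE: "E (v h * a) = (\<Sum>g\<in>carrier G. \<alpha> g (w h) * \<alpha> g a)" for h a
    by (simp add: v_def mult.assoc NE of_nat_expectation act_simps)
  have Ev: "E (a * w h) * v h = (\<Sum>g\<in>carrier G. \<alpha> g a * \<alpha> g (w h)) * w h" for h a
    by (simp add: v_def act_simps mult.assoc[symmetric] mult_of_nat_commute[symmetric]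
        of_nat_expectation)
  have "S a = (\<Sum>g\<in>carrier G. (\<Sum>h\<in>carrier G. w h * \<alpha> g (w h)) * \<alpha> g a)" for a
    unfolding S_def vE sum_distrib_left sum_distrib_right
    by (subst sum.swap) (simp add: mult.assoc)
  moreover have "norm ((\<Sum>h\<in>carrier G. w h * \<alpha> g (w h)) * \<alpha> g a - of_bool (g = \<one>) * a)
      \<le> norm a / (2 * real N)" if g: "g \<in> carrier G" for g a
  proof -
    have "(\<Sum>h\<in>carrier G. w h * \<alpha> g (w h)) * \<alpha> g a - of_bool (g = \<one>) * a =
        ((\<Sum>h\<in>carrier G. w h * \<alpha> g (w h)) - of_bool (g = \<one>)) * \<alpha> g a"
      by (simp add: left_diff_distrib act_one)
    also have "norm \<dots> \<le> 1 / (2 * real N) * norm a"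
      using left[OF g] norm_star_automorphism_le[OF aut[OF g]]
      by (intro order_trans[OF norm_mult_ineq] mult_mono) auto
    finally show ?thesis by simp
  qed
  ultimately have near_S: "norm (S a - a) \<le> norm a / 2" for a
    by (simp only:) (rule norm_sum_act_minus_le, simp only:)
  have S_add: "S (x + y) = S x + S y" for x y
    by (simp add: S_def expectation_add distrib_left sum.distrib)
  then have bijS: "bij S" using near_S by (rule bij_if_near_identity)
  have "T a = (\<Sum>g\<in>carrier G. \<alpha> g a * (\<Sum>h\<in>carrier G. \<alpha> g (w h) * w h))" for a
    unfolding T_def Ev sum_distrib_left sum_distrib_right
    by (subst sum.swap) (simp add: mult.assoc)
  moreover have "norm (\<alpha> g a * (\<Sum>h\<in>carrier G. \<alpha> g (w h) * w h) - of_bool (g = \<one>) * a)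
      \<le> norm a / (2 * real N)" if g: "g \<in> carrier G" for g a
  proof -
    have "\<alpha> g a * (\<Sum>h\<in>carrier G. \<alpha> g (w h) * w h) - of_bool (g = \<one>) * a =
        \<alpha> g a * ((\<Sum>h\<in>carrier G. \<alpha> g (w h) * w h) - of_bool (g = \<one>))"
      by (simp add: right_diff_distrib act_one)
    also have "norm \<dots> \<le> norm a * (1 / (2 * real N))"
      using right[OF g] norm_star_automorphism_le[OF aut[OF g]]
      by (intro order_trans[OF norm_mult_ineq] mult_mono) auto
    finally show ?thesis by simp
  qed
  ultimately have near_T: "norm (T a - a) \<le> norm a / 2" for a
    by (simp only:) (rule norm_sum_act_minus_le, simp only:)
  have T_add: "T (x + y) = T x + T y" for x y
    by (simp add: T_def expectation_add distrib_right sum.distrib)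
  then have bijT: "bij T" using near_T by (rule bij_if_near_identity)
  have E_bimodule: "E (E x * y) = E x * E y" "E (y * E x) = E y * E x" for x y
    by (simp_all add: expectation_fixed_mult act_expectation)
  \<comment> \<open>Linearity over the values of \<open>E\<close>, on the right for \<open>S\<close>
    and on the left for \<open>T\<close>, lets the inverse maps act inside the expansions.\<close>
  have S_mult: "S (x * E y) = S x * E y" and T_mult: "T (E y * x) = E y * T x" for x y
    by (simp_all add: S_def T_def sum_distrib_left sum_distrib_right E_bimodule mult.assoc[symmetric])
      (simp add: mult.assoc E_bimodule)
  have S_sum: "S (\<Sum>i\<in>I. x i) = (\<Sum>i\<in>I. S (x i))" and T_sum: "T (\<Sum>i\<in>I. x i) = (\<Sum>i\<in>I. T (x i))"
    for I :: "'g set" and x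
    using sum_comp_morphism[of S x I] sum_comp_morphism[of T x I] S_add T_add S_add[of 0 0] T_add[of 0 0]
    by (simp_all add: comp_def)
  show ?thesis
  \<comment> \<open>The two corrections yield different pairs, one for each side, which this rule
    combines.\<close>
  proof (rule finite_index_if_left_right[OF finite_carrier finite_carrier expectation_add E_bimodule(1)])
    fix a
    have "S (\<Sum>h\<in>carrier G. inv_into UNIV S (w h) * E (v h * a)) = S a"
      using bijS by (simp add: S_sum S_mult bij_is_surj surj_f_inv_f) (simp add: S_def)
    then show "a = (\<Sum>h\<in>carrier G. inv_into UNIV S (w h) * E (v h * a))"
      using bijS by (simp add: bij_is_inj inj_eq)
    have "T (\<Sum>h\<in>carrier G. E (a * w h) * inv_into UNIV T (v h)) = T a"
      using bijT by (simp add: T_sum T_mult bij_is_surj surj_f_inv_f) (simp add: T_def)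
    then show "a = (\<Sum>h\<in>carrier G. E (a * w h) * inv_into UNIV T (v h))"
      using bijT by (simp add: bij_is_inj inj_eq)
  qed
qed

lemma rohlin_expectation_if_rohlin_action:
  assumes simple: "simple_cstar_algebra TYPE('a)" and "rohlin_action G \<alpha>"
  shows "rohlin_expectation P E"
proof -
  let ?C = "const_seq :: 'a \<Rightarrow> 'a seqalg"
  from assms(2) obtain e where central: "\<And>g. g \<in> carrier G \<Longrightarrow> e g \<in> central_sequences"
    and proj: "\<And>g. g \<in> carrier G \<Longrightarrow> projection (e g)"
    and orth: "\<And>g h. g \<in> carrier G \<Longrightarrow> h \<in> carrier G \<Longrightarrow> g \<noteq> h \<Longrightarrow> e g * e h = 0"
    and sum1: "(\<Sum>g\<in>carrier G. e g) = 1"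
    and shift: "\<And>g h. g \<in> carrier G \<Longrightarrow> h \<in> carrier G \<Longrightarrow> \<beta> g (e h) = e (g \<otimes> h)"
    unfolding rohlin_action_def by blast
  have fin: "finite_index E"
  proof (rule rohlin_action_approx[of e "1 / (2 * real N)"])
    fix w
    assume "\<And>g. g \<in> carrier G \<Longrightarrow>
        norm ((\<Sum>h\<in>carrier G. w h * \<alpha> g (w h)) - of_bool (g = \<one>)) < 1 / (2 * real N)"
      and "\<And>g. g \<in> carrier G \<Longrightarrow>
        norm ((\<Sum>h\<in>carrier G. \<alpha> g (w h) * w h) - of_bool (g = \<one>)) < 1 / (2 * real N)"
    then show ?thesis by (rule finite_index_if_approx)
  qed (use proj orth sum1 shift N_pos in simp_all)
  then obtain n u v where qb: "quasi_basis E n u v" by (auto simp: finite_index_def)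
  have shift1: "\<beta> g (e \<one>) = e g" if "g \<in> carrier G" for g
    using shift[OF that one_closed] that by simp
  have "e \<one> \<noteq> 0"
  proof
    assume "e \<one> = 0"
    then have "e g = 0" if "g \<in> carrier G" for g
      using shift1[OF that] that by (simp add: induced_map_zero aut)
    then show False using sum1 by simp
  qed
  then have ann: "a = 0" if "?C a * e \<one> = 0" for a
    using const_seq_mult_central_eq_0[OF simple central[OF one_closed] that] by simp
  have "?C (coef n u v g) * \<beta> g (e \<one>) * e \<one> = 0" if "g \<in> carrier G" "g \<noteq> \<one>" for g
    using that by (simp add: shift1 orth mult.assoc)
  \<comment> \<open>Right multiplication by \<open>e \<one>\<close> leaves only the term at
    \<open>\<one>\<close> of the expansion of \<open>of_nat N * e \<one>\<close>.\<close>
  then have "(\<Sum>g\<in>carrier G. ?C (coef n u v g) * \<beta> g (e \<one>) * e \<one>) =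
      (\<Sum>g\<in>{\<one>}. ?C (coef n u v g) * \<beta> g (e \<one>) * e \<one>)"
    using finite_carrier by (intro sum.mono_neutral_right) auto
  then have "of_nat N * e \<one> * e \<one> = ?C (Index E) * e \<one> * e \<one>"
    by (simp add: sum_distrib_right[symmetric] sum_coef_induced[OF qb] induced_act_one
        Index_eq_coef[OF qb])
  then have "?C (Index E - of_nat N) * e \<one> = 0"
    using proj[of \<one>] by (simp add: projection_def mult.assoc const_seq_diff left_diff_distrib)
  then have index: "Index E = of_nat N" using ann by fastforce
  define j :: 'a where "j = (1 / real N) *\<^sub>R 1"
  have "of_nat N = real N *\<^sub>R (1 :: 'a)" by (simp add: scaleR_conv_of_real)
  then have jN: "j * of_nat N = 1" "of_nat N * j = 1"
    using N_pos unfolding j_def by simp_all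
  \<comment> \<open>The translates of \<open>e \<one>\<close> are all the projections
    \<open>e g\<close>, which sum to \<open>1\<close>.\<close>
  have "of_nat N * induced_map E (e \<one>) = 1"
    by (simp add: of_nat_induced_expectation shift1 sum1)
  then have "?C (j * of_nat N) * induced_map E (e \<one>) = ?C j"
    by (simp only: const_seq_mult const_seq_of_nat mult.assoc mult_1_right)
  then have "induced_map E (e \<one>) = ?C j" by (simp add: jN)
  moreover have "inj (\<lambda>x. ?C x * e \<one>)"
  proof (rule injI)
    fix x y assume "?C x * e \<one> = ?C y * e \<one>"
    then show "x = y" using ann[of "x - y"] by (simp add: const_seq_diff left_diff_distrib)
  qed
  ultimately show ?thesis
    unfolding rohlin_expectation_def index
    using conditional_expectation fin central[OF one_closed] proj[OF one_closed] jN by blast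
qed

end

text \<open>Injectivity of \<alpha> excludes the trivial action of a nontrivial group: there
  \<open>E\<close> is the identity and has the Rohlin property with projection \<open>1\<close>,
  whereas the action does not.\<close>

theorem proposition3p2:
  fixes G :: "('g, 'b) monoid_scheme"
    and \<alpha> :: "'g \<Rightarrow> 'a::unital_cstar_algebra \<Rightarrow> 'a"
  assumes "group G"
    and "finite (carrier G)"
    and "simple_cstar_algebra TYPE('a)"
    and "\<alpha> \<in> hom G star_Aut"
    and "inj_on \<alpha> (carrier G)"
  shows "rohlin_action G \<alpha> \<longleftrightarrow>
    rohlin_expectation (fixed_point_algebra G \<alpha>) (canonical_expectation G \<alpha>)"
proof -
  interpret group G by (rule assms(1))
  interpret finite_group_action G \<alpha> by unfold_locales (rule assms)+
  show ?thesis
    using rohlin_expectation_if_rohlin_action rohlin_action_if_rohlin_expectation assms(3,5)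
    by blast
qed

end
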